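(* Let $0\le q\le p$, let $\kappa_1,\dots,\kappa_q$ be real constants, let $\nu_{q+1},\dots,\nu_p\in(0,1)$, and for $\alpha=(\alpha_1,\dots,\alpha_q)\in\mathbb{N}^q$ and $\beta=(\beta_{q+1},\dots,\beta_p)\in\mathbb{N}^{p-q}$ set $\nu_\beta:=\beta_{q+1}\nu_{q+1}+\dots+\beta_p\nu_p$ and $$\mathscr T_{\alpha,\beta}(\zeta):=\prod_{k=1}^q(\log\zeta+\kappa_k)^{-\alpha_k}\prod_{k=q+1}^p\zeta^{-\beta_k\nu_k},$$ with the branch of the logarithm fixed on $\mathbb{C}\setminus\mathbb{R}^-$. Let $$\mathscr L^{-1}(\mathscr T_{\alpha,\beta})(t)=\frac{1}{2\pi i}\int_{\delta+i\mathbb{R}}e^{t\zeta}\,\mathscr T_{\alpha,\beta}(\zeta)\,d\zeta$$ for a fixed $\delta>0$. Then, up to additive components which are smooth functions in $C^\infty[0,\infty)$, there are constants $E_{\beta k}$ such that $$\mathscr L^{-1}(\mathscr T_{\alpha,\beta})(t)\sim\sum_{k=0}^\infty E_{\beta k}\,t^{-1+\nu_\beta}\log^{-|\alpha|-k}(t),\qquad t\to0,$$ where $|\alpha|=\alpha_1+\dots+\alpha_q$.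
   Formalization: It is assumed that δ ≠ e^{-κ_k} whenever α_k > 0 (otherwise the integrand has a pole on the line of integration) and that α and β are not both zero (otherwise the integral diverges); the integral is taken as a symmetric limit. *)

theory Defs
  imports "HOL-Complex_Analysis.Complex_Analysis"
begin

definition Tab :: "nat \<Rightarrow> nat \<Rightarrow> (nat \<Rightarrow> real) \<Rightarrow> (nat \<Rightarrow> real) \<Rightarrow> (nat \<Rightarrow> nat) \<Rightarrow> (nat \<Rightarrow> nat)
                   \<Rightarrow> complex \<Rightarrow> complex" where
  "Tab q p \<kappa> \<nu> \<alpha> \<beta> z =
     (\<Prod>k\<in>{1..q}. (Ln z + complex_of_real (\<kappa> k)) powi (- int (\<alpha> k))) *
     (\<Prod>k\<in>{q+1..p}. z powr (- complex_of_real (real (\<beta> k) * \<nu> k)))"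

definition smooth_nonneg :: "(real \<Rightarrow> complex) \<Rightarrow> bool" where
  "smooth_nonneg g \<longleftrightarrow> (\<exists>D :: nat \<Rightarrow> real \<Rightarrow> complex. D 0 = g \<and>
      (\<forall>n. \<forall>x\<ge>0. (D n has_vector_derivative D (Suc n) x) (at x within {0..})))"

end

theory Submission
  imports Defs
begin

text \<open>Write T for the symbol and z = s / t. Moving the line of integration to the right of all
  poles, to Re z = 1 / t, changes the integral only by integrals of exp (t z) T z over a fixed
  compact contour, which are smooth in t; the horizontal sides vanish in the limit because T tends
  to 0 at infinity. Two integrations by parts replace T by T'' / t^2, which decays faster than
  1 / |z| uniformly along the line, so no bent contour is needed. After rescaling, T'' becomes
  s^(- nu - 2) times a rational function of log s - log t, and this is expanded in powers of
  1 / log t, with coefficients polynomial in log s, under an absolutely convergent integral over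
  Re s = 1.\<close>

section \<open>Shifting vertical contours\<close>

text \<open>When all \<beta> k vanish, T decays only like a power of 1 / log |z|, so the inversion
  integral need not converge absolutely and is taken as a limit over symmetric segments. The poles
  exp (- \<kappa> k) all lie on the real axis, so T is holomorphic off that axis and the shift past
  them works with primitives instead of residues. The abscissa is changed twice: from \<delta> to a
  fixed c beyond the poles, which leaves one smooth term serving every t and N, and then from c to 1
  / t, which costs nothing. On Re z = 1 / t the factor exp (t z) has constant modulus and s = t z
  runs over Re s = 1. There |s| >= 1, so Re (log s) >= 0. With x = 1 / log (1/t) one has log z +
  \<kappa> = (1 + (\<kappa> + log s) x) / x, and the numerator has real part at least 1/2 as soon as
  x |\<kappa>| <= 1/2, however large |log s| x is. Hence a finite geometric sum with its exact
  remainder is usable on the whole line, without splitting by the size of s.\<close>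

abbreviation (input) vline :: "real \<Rightarrow> real \<Rightarrow> (complex \<Rightarrow> complex) \<Rightarrow> complex" where
  "vline a R f \<equiv> contour_integral (linepath (Complex a (- R)) (Complex a R)) f"

lemma continuous_on_Complex: "continuous_on A (Complex a)"
  by (simp add: Complex_eq continuous_intros)

lemma contour_integral_linepath_primitive:
  assumes "convex S" "a \<in> S" "b \<in> S"
    and "\<And>z. z \<in> S \<Longrightarrow> (P has_field_derivative f z) (at z within S)"
  shows "contour_integral (linepath a b) f = P b - P a"
proof -
  have "(f has_contour_integral (P (pathfinish (linepath a b)) - P (pathstart (linepath a b)))) (linepath a b)"
    by (rule contour_integral_primitive[OF assms(4)])
       (use assms(1-3) in \<open>auto simp: closed_segment_subset\<close>)
  then show ?thesis
    by (simp add: contour_integral_unique)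
qed

lemma closed_segment_vertical:
  "closed_segment (Complex a c) (Complex a d) = Complex a ` closed_segment c d"
proof
  show "closed_segment (Complex a c) (Complex a d) \<subseteq> Complex a ` closed_segment c d"
    by (force simp: in_segment complex_eq_iff algebra_simps image_iff)
  show "Complex a ` closed_segment c d \<subseteq> closed_segment (Complex a c) (Complex a d)"
    by (fastforce simp: in_segment complex_eq_iff algebra_simps)
qed

text \<open>Each open half-plane is convex, so f has one primitive above and one below the real
  axis, and the axis enters only through continuity where the two lines cross it. What survives is
  the boundary of the rectangle between heights -1 and 1, clockwise when a < b. Poles inside it call
  for no residues: all that matters later is that this contour is fixed and compact.\<close>

lemma contour_integral_shift_vertical:
  assumes hol: "f holomorphic_on {z. Im z \<noteq> 0}"
    and cont: "continuous_on (closed_segment (Complex a (-1)) (Complex a 1)) f"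
      "continuous_on (closed_segment (Complex b (-1)) (Complex b 1)) f"
    and top: "((\<lambda>R. contour_integral (linepath (Complex a R) (Complex b R)) f) \<longlongrightarrow> 0) at_top"
    and bot: "((\<lambda>R. contour_integral (linepath (Complex a (-R)) (Complex b (-R))) f) \<longlongrightarrow> 0) at_top"
  shows "((\<lambda>R. vline a R f - vline b R f) \<longlongrightarrow>
     vline a 1 f + contour_integral (linepath (Complex a 1) (Complex b 1)) f
     - vline b 1 f - contour_integral (linepath (Complex a (-1)) (Complex b (-1))) f) at_top"
proof -
  have cvx: "convex {z. Im z > 0}" "convex {z. Im z < 0}"
    by (rule convex_halfspace_Im_gt, rule convex_halfspace_Im_lt)
  obtain P where P: "\<And>z. z \<in> {z. Im z > 0} \<Longrightarrow> (P has_field_derivative f z) (at z within {z. Im z > 0})"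
    by (rule holomorphic_convex_primitive'[OF cvx(1) open_halfspace_Im_gt])
       (use hol in \<open>auto elim: holomorphic_on_subset\<close>)
  obtain Q where Q: "\<And>z. z \<in> {z. Im z < 0} \<Longrightarrow> (Q has_field_derivative f z) (at z within {z. Im z < 0})"
    by (rule holomorphic_convex_primitive'[OF cvx(2) open_halfspace_Im_lt])
       (use hol in \<open>auto elim: holomorphic_on_subset\<close>)
  have p: "contour_integral (linepath u v) f = P v - P u" if "Im u > 0" "Im v > 0" for u v
    by (rule contour_integral_linepath_primitive[OF cvx(1)]) (use that P in auto)
  have q: "contour_integral (linepath u v) f = Q v - Q u" if "Im u < 0" "Im v < 0" for u v
    by (rule contour_integral_linepath_primitive[OF cvx(2)]) (use that Q in auto)
  \<comment> \<open>The line is cut at heights -1 and 1: the tails are evaluated by Q and P, and the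
    part crossing the real axis stays an integral.\<close>
  have split: "vline c R f = Q (Complex c (-1)) - Q (Complex c (-R)) + vline c 1 f
      + (P (Complex c R) - P (Complex c 1))"
    if R: "R > 1" and c: "continuous_on (closed_segment (Complex c (-1)) (Complex c 1)) f" for c R
  proof -
    \<comment> \<open>Continuity is glued from closed pieces: the hypothesis covers the crossing,
      holomorphy off the axis covers the tails.\<close>
    have sub: "closed_segment (Complex c (-R)) (Complex c R)
       \<subseteq> closed_segment (Complex c (-1)) (Complex c 1) \<union> {z \<in> Complex c ` UNIV. Im z \<ge> 1} \<union> {z \<in> Complex c ` UNIV. Im z \<le> -1}"
      by (force simp: closed_segment_vertical closed_segment_eq_real_ivl)
    have cl: "closed (range (Complex c))"
    proof -
      have "range (Complex c) = {z. Re z = c}"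
        by (auto simp: image_iff complex_eq_iff)
      then show ?thesis by (simp add: closed_halfspace_Re_eq)
    qed
    have cl2: "closed {z \<in> range (Complex c). Im z \<ge> 1}" "closed {z \<in> range (Complex c). Im z \<le> -1}"
      using closed_Int[OF cl closed_halfspace_Im_ge[of 1]] closed_Int[OF cl closed_halfspace_Im_le[of "-1"]]
      by (simp_all add: Int_def)
    have "continuous_on {z. Im z \<noteq> 0} f"
      using hol holomorphic_on_imp_continuous_on by blast
    then have "continuous_on {z \<in> range (Complex c). Im z \<ge> 1} f" "continuous_on {z \<in> range (Complex c). Im z \<le> -1} f"
      by (auto elim!: continuous_on_subset)
    then have "continuous_on (closed_segment (Complex c (-1)) (Complex c 1) \<union> {z \<in> Complex c ` UNIV. Im z \<ge> 1} \<union> {z \<in> Complex c ` UNIV. Im z \<le> -1}) f"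
      by (intro continuous_on_closed_Un c cl2 closed_Un closed_segment)
    then have cR: "continuous_on (closed_segment (Complex c (-R)) (Complex c R)) f"
      using sub continuous_on_subset by blast
    have s1: "Complex c (-1) \<in> closed_segment (Complex c (-R)) (Complex c R)"
      and s2: "Complex c 1 \<in> closed_segment (Complex c (-1)) (Complex c R)"
      and s3: "closed_segment (Complex c (-1)) (Complex c R) \<subseteq> closed_segment (Complex c (-R)) (Complex c R)"
      using R by (auto simp: closed_segment_vertical closed_segment_eq_real_ivl)
    have "vline c R f = contour_integral (linepath (Complex c (-R)) (Complex c (-1))) f + 
        contour_integral (linepath (Complex c (-1)) (Complex c R)) f"
      by (rule contour_integral_split_linepath[OF cR s1])
    also have "contour_integral (linepath (Complex c (-1)) (Complex c R)) f = vline c 1 f + contour_integral (linepath (Complex c 1) (Complex c R)) f"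
      by (rule contour_integral_split_linepath[OF continuous_on_subset[OF cR s3] s2])
    finally show ?thesis
      using R by (simp add: p q)
  qed
  \<comment> \<open>Subtracting the two splittings pairs values of P, or of Q, at equal heights.
    Each pair is a horizontal integral, and those at heights R and -R tend to 0.\<close>
  have "((\<lambda>R. contour_integral (linepath (Complex a (-R)) (Complex b (-R))) f 
     - contour_integral (linepath (Complex a R) (Complex b R)) f +
    (vline a 1 f + contour_integral (linepath (Complex a 1) (Complex b 1)) f
     - vline b 1 f - contour_integral (linepath (Complex a (-1)) (Complex b (-1))) f)) \<longlongrightarrow> 0 - 0 +
     (vline a 1 f + contour_integral (linepath (Complex a 1) (Complex b 1)) f
     - vline b 1 f - contour_integral (linepath (Complex a (-1)) (Complex b (-1))) f)) at_top"
    by (intro tendsto_intros top bot)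
  moreover have "\<forall>\<^sub>F R in at_top. contour_integral (linepath (Complex a (-R)) (Complex b (-R))) f 
     - contour_integral (linepath (Complex a R) (Complex b R)) f +
    (vline a 1 f + contour_integral (linepath (Complex a 1) (Complex b 1)) f
     - vline b 1 f - contour_integral (linepath (Complex a (-1)) (Complex b (-1))) f)
     = vline a R f - vline b R f"
    using eventually_gt_at_top[of 1]
  proof eventually_elim
    case (elim R)
    show ?case
      using elim unfolding split[OF elim cont(1)] split[OF elim cont(2)] by (simp add: p q)
  qed
  ultimately show ?thesis
    by (simp add: tendsto_cong)
qed

text \<open>One primitive on the whole half-plane leaves no rectangle over. This shift serves the
  abscissa 1 / t, which moves with t and must not contribute to the smooth term.\<close>

lemma contour_integral_shift_vertical_halfplane:
  assumes hol: "f holomorphic_on {z. Re z > c}" and ab: "a > c" "b > c"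
    and top: "((\<lambda>R. contour_integral (linepath (Complex a R) (Complex b R)) f) \<longlongrightarrow> 0) at_top"
    and bot: "((\<lambda>R. contour_integral (linepath (Complex a (-R)) (Complex b (-R))) f) \<longlongrightarrow> 0) at_top"
  shows "((\<lambda>R. vline a R f - vline b R f) \<longlongrightarrow> 0) at_top"
proof -
  obtain P where P: "\<And>z. z \<in> {z. Re z > c} \<Longrightarrow> (P has_field_derivative f z) (at z within {z. Re z > c})"
    using holomorphic_convex_primitive'[OF convex_halfspace_Re_gt open_halfspace_Re_gt hol] by blast
  have p: "contour_integral (linepath u v) f = P v - P u" if "Re u > c" "Re v > c" for u v
    by (rule contour_integral_linepath_primitive[OF convex_halfspace_Re_gt]) (use that P in auto)
  have "((\<lambda>R. contour_integral (linepath (Complex a (-R)) (Complex b (-R))) f 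
     - contour_integral (linepath (Complex a R) (Complex b R)) f) \<longlongrightarrow> 0 - 0) at_top"
    by (intro tendsto_intros top bot)
  then show ?thesis
    using ab by (simp add: p algebra_simps)
qed

text \<open>The segment has fixed length and Re z stays bounded on it, so the exponential is bounded
  and T tending to 0 at any rate is enough. The filter \<open>at_infinity\<close> on the reals
  treats both horizontal sides at once.\<close>

lemma horizontal_integral_tendsto_0:
  fixes t :: real
  assumes T: "(T \<longlongrightarrow> 0) at_infinity" and cont: "continuous_on {z. Im z \<noteq> 0} T"
  shows "((\<lambda>y. contour_integral (linepath (Complex a y) (Complex b y)) (\<lambda>z. exp (of_real t * z) * T z))
           \<longlongrightarrow> 0) (at_infinity :: real filter)"
proof (rule tendstoI)
  fix e :: real assume "e > 0"
  \<comment> \<open>The summand 1 keeps K positive when a = b and makes the final inequality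
    strict.\<close>
  define K where "K = exp (\<bar>t\<bar> * (\<bar>a\<bar> + \<bar>b\<bar>)) * (\<bar>b - a\<bar> + 1)"
  have "K > 0" by (simp add: K_def)
  then have "\<forall>\<^sub>F z in at_infinity. dist (T z) 0 < e / K"
    using \<open>e > 0\<close> by (intro tendstoD[OF T]) simp
  then obtain B where B: "\<And>z. cmod z \<ge> B \<Longrightarrow> cmod (T z) < e / K"
    by (auto simp: eventually_at_infinity)
  \<comment> \<open>The height is also kept at least 1 so that the segment avoids the real axis,
    where T may fail to be continuous.\<close>
  have "cmod (contour_integral (linepath (Complex a y) (Complex b y)) (\<lambda>z. exp (of_real t * z) * T z)) < e"
    if y: "\<bar>y\<bar> \<ge> max B 1" for y
  proof -
    have seg: "Im z = y \<and> \<bar>Re z\<bar> \<le> \<bar>a\<bar> + \<bar>b\<bar>" if z: "z \<in> closed_segment (Complex a y) (Complex b y)" for z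
    proof -
      obtain u where u: "0 \<le> u" "u \<le> 1" "z = (1 - u) *\<^sub>R Complex a y + u *\<^sub>R Complex b y"
        using z by (auto simp: in_segment)
      have "\<bar>(1 - u) * a + u * b\<bar> \<le> \<bar>1 - u\<bar> * \<bar>a\<bar> + \<bar>u\<bar> * \<bar>b\<bar>"
        by (metis abs_mult abs_triangle_ineq)
      also have "\<dots> \<le> 1 * \<bar>a\<bar> + 1 * \<bar>b\<bar>"
        using u by (intro add_mono mult_right_mono) auto
      finally have "\<bar>(1 - u) * a + u * b\<bar> \<le> \<bar>a\<bar> + \<bar>b\<bar>" by simp
      moreover have "Re z = (1 - u) * a + u * b" "Im z = (1 - u) * y + u * y" using u by simp_all
      ultimately show ?thesis by (simp add: algebra_simps)
    qed
    have nz: "y \<noteq> 0" using y by auto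
    have cancel: "exp v * (e / (exp v * k)) * X = e * (X / k)" for v k X :: real
      by simp
    have "cmod (contour_integral (linepath (Complex a y) (Complex b y)) (\<lambda>z. exp (of_real t * z) * T z))
       \<le> (exp (\<bar>t\<bar> * (\<bar>a\<bar> + \<bar>b\<bar>)) * (e / K)) * cmod (Complex b y - Complex a y)"
    proof (rule contour_integral_bound_linepath)
      show "(\<lambda>z. exp (of_real t * z) * T z) contour_integrable_on linepath (Complex a y) (Complex b y)"
        using seg nz
        by (intro contour_integrable_continuous_linepath continuous_intros continuous_on_subset[OF cont]) force
      show "0 \<le> exp (\<bar>t\<bar> * (\<bar>a\<bar> + \<bar>b\<bar>)) * (e / K)"
        using \<open>e > 0\<close> \<open>K > 0\<close> by simp
      fix z assume z: "z \<in> closed_segment (Complex a y) (Complex b y)"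
      have "t * Re z \<le> \<bar>t\<bar> * \<bar>Re z\<bar>" by (metis abs_ge_self abs_mult)
      also have "\<dots> \<le> \<bar>t\<bar> * (\<bar>a\<bar> + \<bar>b\<bar>)" using seg[OF z] by (intro mult_left_mono) auto
      finally have "cmod (exp (of_real t * z)) \<le> exp (\<bar>t\<bar> * (\<bar>a\<bar> + \<bar>b\<bar>))" by simp
      moreover have "cmod z \<ge> B"
        using seg[OF z] y abs_Im_le_cmod[of z] by auto
      ultimately show "cmod (exp (of_real t * z) * T z) \<le> exp (\<bar>t\<bar> * (\<bar>a\<bar> + \<bar>b\<bar>)) * (e / K)"
        using B[of z] unfolding norm_mult by (intro mult_mono) auto
    qed
    also have "Complex b y - Complex a y = of_real (b - a)"
      by (simp add: complex_eq_iff)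
    also have "(exp (\<bar>t\<bar> * (\<bar>a\<bar> + \<bar>b\<bar>)) * (e / K)) * cmod (of_real (b - a)) = e * (\<bar>b - a\<bar> / (\<bar>b - a\<bar> + 1))"
      unfolding K_def norm_of_real using cancel .
    also have "\<dots> < e * 1"
      using \<open>e > 0\<close> by (intro mult_strict_left_mono) (auto simp: field_simps)
    finally show ?thesis by simp
  qed
  then show "\<forall>\<^sub>F y in at_infinity. dist (contour_integral (linepath (Complex a y) (Complex b y)) (\<lambda>z. exp (of_real t * z) * T z)) 0 < e"
    unfolding eventually_at_infinity by (auto simp: intro!: exI[of _ "max B 1"])
qed

lemma horizontal_integral_tendsto_0_top_bot:
  fixes t :: real
  assumes T: "(T \<longlongrightarrow> 0) at_infinity" and cont: "continuous_on {z. Im z \<noteq> 0} T"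
  shows "((\<lambda>R. contour_integral (linepath (Complex a R) (Complex b R)) (\<lambda>z. exp (of_real t * z) * T z))
           \<longlongrightarrow> 0) at_top"
    and "((\<lambda>R. contour_integral (linepath (Complex a (-R)) (Complex b (-R))) (\<lambda>z. exp (of_real t * z) * T z))
           \<longlongrightarrow> 0) at_top"
proof -
  note * = horizontal_integral_tendsto_0[OF assms, of a b t]
  show "((\<lambda>R. contour_integral (linepath (Complex a R) (Complex b R)) (\<lambda>z. exp (of_real t * z) * T z))
           \<longlongrightarrow> 0) at_top"
    by (rule tendsto_mono[OF at_top_le_at_infinity *])
  show "((\<lambda>R. contour_integral (linepath (Complex a (-R)) (Complex b (-R))) (\<lambda>z. exp (of_real t * z) * T z))
           \<longlongrightarrow> 0) at_top"
    by (rule filterlim_compose[OF tendsto_mono[OF at_bot_le_at_infinity *] filterlim_uminus_at_bot_at_top])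
qed

section \<open>Smoothness up to t = 0 of exponential integrals over compact segments\<close>

lemma smooth_nonneg_add:
  assumes "smooth_nonneg f" "smooth_nonneg g"
  shows "smooth_nonneg (\<lambda>t. f t + g t)"
proof -
  obtain D E where "D 0 = f" "E 0 = g"
    and "\<forall>n. \<forall>x\<ge>0. (D n has_vector_derivative D (Suc n) x) (at x within {0..})"
    and "\<forall>n. \<forall>x\<ge>0. (E n has_vector_derivative E (Suc n) x) (at x within {0..})"
    using assms unfolding smooth_nonneg_def by metis
  then show ?thesis
    unfolding smooth_nonneg_def
    by (intro exI[of _ "\<lambda>n t. D n t + E n t"]) (auto intro!: has_vector_derivative_add)
qed

lemma smooth_nonneg_cmult:
  assumes "smooth_nonneg f"
  shows "smooth_nonneg (\<lambda>t. c * f t)"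
proof -
  obtain D where "D 0 = f"
    and "\<forall>n. \<forall>x\<ge>0. (D n has_vector_derivative D (Suc n) x) (at x within {0..})"
    using assms unfolding smooth_nonneg_def by metis
  then show ?thesis
    unfolding smooth_nonneg_def
    by (intro exI[of _ "\<lambda>n t. c * D n t"]) (auto intro!: has_vector_derivative_mult_right)
qed

text \<open>Each t-derivative only inserts a further factor z, and on a compact segment all these
  integrands are jointly continuous, so differentiation under the integral is valid for every t >=
  0, the endpoint included.\<close>

lemma smooth_nonneg_laplace_linepath:
  assumes h: "continuous_on (closed_segment a b) h"
  shows "smooth_nonneg (\<lambda>t. contour_integral (linepath a b) (\<lambda>z. exp (of_real t * z) * h z))"
proof -
  define D where "D = (\<lambda>(n::nat) (t::real). integral (cbox 0 (1::real))
     (\<lambda>x. linepath a b x ^ n * exp (of_real t * linepath a b x) * h (linepath a b x) * (b - a)))"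
  have hl: "continuous_on {0..1} (\<lambda>x. h (linepath a b x))"
    by (rule continuous_on_compose2[OF h continuous_on_linepath]) (auto simp: linepath_in_path)
  have hl2: "continuous_on ({0..} \<times> {0..1}) (\<lambda>z::real\<times>real. h (linepath a b (snd z)))"
    by (rule continuous_on_compose2[OF hl continuous_on_snd[OF continuous_on_id]]) auto
  have "D 0 = (\<lambda>t. contour_integral (linepath a b) (\<lambda>z. exp (of_real t * z) * h z))"
    by (simp add: D_def fun_eq_iff contour_integral_integral)
  moreover have "(D n has_vector_derivative D (Suc n) t) (at t within {0..})" if "t \<ge> 0" for n t
    unfolding D_def
  proof (rule leibniz_rule_vector_derivative)
    fix t x :: real
    show "((\<lambda>t. linepath a b x ^ n * exp (of_real t * linepath a b x) * h (linepath a b x) * (b - a))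
       has_vector_derivative linepath a b x ^ Suc n * exp (of_real t * linepath a b x) * h (linepath a b x) * (b - a))
        (at t within {0..})"
      by (auto intro!: derivative_eq_intros has_vector_derivative_real_field simp: algebra_simps)
    show "(\<lambda>x. linepath a b x ^ n * exp (of_real t * linepath a b x) * h (linepath a b x) * (b - a)) integrable_on cbox 0 1"
      by (intro integrable_continuous continuous_intros) (use hl in auto)
    show "continuous_on ({0..} \<times> cbox 0 1) (\<lambda>(t, x). linepath a b x ^ Suc n * exp (of_real t * linepath a b x) * h (linepath a b x) * (b - a))"
      unfolding case_prod_unfold 
      by (intro continuous_intros continuous_on_compose2[OF continuous_on_linepath continuous_on_snd]) (use hl2 in auto)
  qed (use that in auto)
  ultimately show ?thesis
    unfolding smooth_nonneg_def by blast
qed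

section \<open>Limits of truncated vertical integrals, and the two integrations by parts\<close>

lemma vline_tendsto_lborel:
  assumes "integrable lborel (\<lambda>y. f (Complex a y))" "continuous_on (range (Complex a)) f"
  shows "((\<lambda>R. vline a R f) \<longlongrightarrow> \<i> * (\<integral>y. f (Complex a y) \<partial>lborel)) at_top"
proof -
  have c: "continuous_on {-R..R} (\<lambda>y. f (Complex a y))" for R
    by (rule continuous_on_compose2[OF assms(2) continuous_on_Complex]) auto
  have "((\<lambda>R. \<integral>y. indicator {-R..R} y *\<^sub>R f (Complex a y) \<partial>lborel) \<longlongrightarrow> \<integral>y. f (Complex a y) \<partial>lborel) at_top"
  proof (rule integral_dominated_convergence_at_top[where w = "\<lambda>y. cmod (f (Complex a y))"])
    show "(\<lambda>y. f (Complex a y)) \<in> borel_measurable lborel" using assms(1) by auto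
    then show "(\<lambda>y. indicator {-R..R} y *\<^sub>R f (Complex a y)) \<in> borel_measurable lborel" for R
      by measurable
    show "AE y in lborel. ((\<lambda>R. indicator {-R..R} y *\<^sub>R f (Complex a y)) \<longlongrightarrow> f (Complex a y)) at_top"
    proof (rule AE_I2)
      fix y :: real
      have "\<forall>\<^sub>F R in at_top. indicator {-R..R} y *\<^sub>R f (Complex a y) = f (Complex a y)"
        using eventually_ge_at_top[of "\<bar>y\<bar>"] by eventually_elim (auto simp: indicator_def abs_le_iff)
      then show "((\<lambda>R. indicator {-R..R} y *\<^sub>R f (Complex a y)) \<longlongrightarrow> f (Complex a y)) at_top"
        by (rule tendsto_eventually)
    qed
  qed (use assms(1) in \<open>auto simp: indicator_def\<close>)
  then have "((\<lambda>R. \<i> * (\<integral>y. indicator {-R..R} y *\<^sub>R f (Complex a y) \<partial>lborel)) \<longlongrightarrow> \<i> * (\<integral>y. f (Complex a y) \<partial>lborel)) at_top"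
    by (intro tendsto_intros)
  moreover have "\<forall>\<^sub>F R in at_top. \<i> * (\<integral>y. indicator {-R..R} y *\<^sub>R f (Complex a y) \<partial>lborel) = vline a R f"
    using eventually_gt_at_top[of 0]
  proof eventually_elim
    case (elim R)
    have "set_integrable lborel {-R..R} (\<lambda>y. f (Complex a y))"
      by (rule borel_integrable_compact[OF compact_Icc c, folded set_integrable_def])
    from set_borel_integral_eq_integral(2)[OF this] show ?case
      using elim by (simp add: set_lebesgue_integral_def contour_integral_linepath_same_Re[of _ a _ "-R" R])
  qed
  ultimately show ?thesis
    by (rule Lim_transform_eventually)
qed

lemma filterlim_Complex_at_infinity:
  "filterlim (Complex a) at_infinity at_top" "filterlim (\<lambda>y. Complex a (- y)) at_infinity at_top"
proof -
  have "\<bar>y\<bar> \<le> cmod (Complex a y)" for y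
    using abs_Im_le_cmod[of "Complex a y"] by simp
  moreover have "y \<le> \<bar>y\<bar>" "y \<le> \<bar>- y\<bar>" for y :: real by auto
  ultimately have "y \<le> cmod (Complex a y)" "y \<le> cmod (Complex a (- y))" for y
    by (meson order_trans)+
  then show "filterlim (Complex a) at_infinity at_top" "filterlim (\<lambda>y. Complex a (- y)) at_infinity at_top"
    by (auto intro!: filterlim_norm_at_top_imp_at_infinity filterlim_at_top_mono[OF filterlim_ident] always_eventually)
qed

text \<open>Both integrations by parts are done at once by \<open>Q\<close>, a primitive of exp (t
  z) (T z - T2 z / t^2) along the line. Integrability is asked of T2 alone; for T and T1 decay
  without a rate suffices to remove the boundary terms.\<close>

lemma vline_laplace_tendsto:
  fixes t :: real
  assumes t: "t > 0"
    and d: "\<And>z. Re z = a \<Longrightarrow> (T has_field_derivative T1 z) (at z)"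
      "\<And>z. Re z = a \<Longrightarrow> (T1 has_field_derivative T2 z) (at z)"
    and lim: "(T \<longlongrightarrow> 0) at_infinity" "(T1 \<longlongrightarrow> 0) at_infinity"
    and cont: "continuous_on (range (Complex a)) T2"
    and int: "integrable lborel (\<lambda>y. T2 (Complex a y))"
  shows "((\<lambda>R. vline a R (\<lambda>z. exp (of_real t * z) * T z)) \<longlongrightarrow>
     \<i> * (\<integral>y. exp (of_real t * Complex a y) * T2 (Complex a y) \<partial>lborel) / of_real t ^ 2) at_top"
proof -
  define Q where "Q = (\<lambda>z. exp (of_real t * z) * (T z / of_real t - T1 z / of_real t ^ 2))"
  have Q: "(Q has_field_derivative exp (of_real t * z) * T z - exp (of_real t * z) * T2 z / of_real t ^ 2) (at z)"
    if "Re z = a" for z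
    unfolding Q_def using t
    by (auto intro!: derivative_eq_intros d that simp: field_simps power2_eq_square)
  \<comment> \<open>On Re z = a the exponential has the constant modulus exp (t a), so the limits of
    T and T1 decide.\<close>
  have Qlim: "((\<lambda>R. Q (g R)) \<longlongrightarrow> 0) at_top" if g: "filterlim g at_infinity at_top" and r: "\<And>R. Re (g R) = a" for g :: "real \<Rightarrow> complex"
  proof -
    have "((\<lambda>R. T (g R) / of_real t - T1 (g R) / of_real t ^ 2) \<longlongrightarrow> 0 / of_real t - 0 / of_real t ^ 2) at_top"
      using t by (intro tendsto_intros filterlim_compose[OF lim(1) g] filterlim_compose[OF lim(2) g]) auto
    then have "((\<lambda>R. exp (t * a) * cmod (T (g R) / of_real t - T1 (g R) / of_real t ^ 2)) \<longlongrightarrow> exp (t * a) * cmod 0) at_top"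
      by (intro tendsto_intros) simp
    then have "((\<lambda>R. cmod (Q (g R))) \<longlongrightarrow> 0) at_top"
      by (simp add: Q_def norm_mult r)
    then show ?thesis by (rule tendsto_norm_zero_cancel)
  qed
  have int2: "integrable lborel (\<lambda>y. exp (of_real t * Complex a y) * T2 (Complex a y))"
  proof (rule Bochner_Integration.integrable_bound)
    show "integrable lborel (\<lambda>y. exp (t * a) * cmod (T2 (Complex a y)))"
      using int by auto
    have [measurable]: "Complex a \<in> borel_measurable borel"
      by (intro borel_measurable_continuous_onI continuous_on_Complex)
    have [measurable]: "(\<lambda>y. T2 (Complex a y)) \<in> borel_measurable lborel"
      using int by auto
    have "exp \<in> borel_measurable (borel :: complex measure)"
      by (intro borel_measurable_continuous_onI continuous_intros)
    note [measurable] = measurable_compose[OF _ this]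
    show "(\<lambda>y. exp (of_real t * Complex a y) * T2 (Complex a y)) \<in> borel_measurable lborel"
      by measurable
  qed (simp add: norm_mult)
  have "((\<lambda>R. (Q (Complex a R) - Q (Complex a (- R))) + vline a R (\<lambda>z. exp (of_real t * z) * T2 z) / of_real t ^ 2)
    \<longlongrightarrow> 0 - 0 + (\<i> * (\<integral>y. exp (of_real t * Complex a y) * T2 (Complex a y) \<partial>lborel)) / of_real t ^ 2) at_top"
    using t
    by (intro tendsto_intros Qlim filterlim_Complex_at_infinity vline_tendsto_lborel[where f = "\<lambda>z. exp (of_real t * z) * T2 z"] int2 cont continuous_intros) auto
  moreover have "(Q (Complex a R) - Q (Complex a (- R))) + vline a R (\<lambda>z. exp (of_real t * z) * T2 z) / of_real t ^ 2
     = vline a R (\<lambda>z. exp (of_real t * z) * T z)" for R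
  proof -
    have sub: "closed_segment (Complex a (-R)) (Complex a R) \<subseteq> range (Complex a)"
      by (auto simp: closed_segment_vertical)
    have cT2: "continuous_on (closed_segment (Complex a (-R)) (Complex a R)) T2"
      using cont sub continuous_on_subset by blast
    have cT: "continuous_on (closed_segment (Complex a (-R)) (Complex a R)) T"
      by (rule continuous_at_imp_continuous_on) (use sub in \<open>auto intro!: DERIV_isCont d\<close>)
    have "((\<lambda>z. exp (of_real t * z) * T z - exp (of_real t * z) * T2 z / of_real t ^ 2) has_contour_integral
       Q (pathfinish (linepath (Complex a (-R)) (Complex a R))) - Q (pathstart (linepath (Complex a (-R)) (Complex a R)))) (linepath (Complex a (-R)) (Complex a R))"
      by (rule contour_integral_primitive[where S = "range (Complex a)"])
         (use sub in \<open>auto intro!: has_field_derivative_at_within Q\<close>)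
    then have "contour_integral (linepath (Complex a (-R)) (Complex a R)) (\<lambda>z. exp (of_real t * z) * T z - exp (of_real t * z) * T2 z / of_real t ^ 2)
        = Q (Complex a R) - Q (Complex a (- R))"
      by (simp add: contour_integral_unique)
    moreover have "contour_integral (linepath (Complex a (-R)) (Complex a R)) (\<lambda>z. exp (of_real t * z) * T z - exp (of_real t * z) * T2 z / of_real t ^ 2)
       = vline a R (\<lambda>z. exp (of_real t * z) * T z) - vline a R (\<lambda>z. exp (of_real t * z) * T2 z / of_real t ^ 2)"
      using t by (intro contour_integral_diff contour_integrable_continuous_linepath continuous_intros cT cT2) auto
    moreover have "vline a R (\<lambda>z. exp (of_real t * z) * T2 z / of_real t ^ 2) = vline a R (\<lambda>z. exp (of_real t * z) * T2 z) / of_real t ^ 2"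
      by (intro contour_integral_div contour_integrable_continuous_linepath continuous_intros cT2)
    ultimately show ?thesis by (metis (no_types, lifting) diff_add_cancel)
  qed
  ultimately show ?thesis by simp
qed

section \<open>Expansions with polynomially growing coefficients\<close>

text \<open>Here x stands for 1 / log (1/t) and u for the logarithm of the rescaled
  integration variable; errors may grow polynomially in u, since the remaining
  integrand decays like a power of its variable.\<close>

definition poly_bound :: "real \<Rightarrow> nat \<Rightarrow> (real \<Rightarrow> complex \<Rightarrow> complex) \<Rightarrow> bool" where
  "poly_bound x0 N r \<longleftrightarrow> (\<exists>C M. 0 \<le> C \<and>
     (\<forall>x u. 0 < x \<and> x \<le> x0 \<and> 0 \<le> Re u \<longrightarrow> cmod (r x u) \<le> C * (1 + cmod u) ^ M * x ^ N))"

text \<open>The constants hidden in \<open>poly_bound\<close> may depend on N, so this is an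
  asymptotic series and convergence is not claimed. The case N = 0 bounds \<phi> itself, which
  products and integrability rely on.\<close>

definition poly_expansion :: "real \<Rightarrow> (real \<Rightarrow> complex \<Rightarrow> complex) \<Rightarrow> (nat \<Rightarrow> complex poly) \<Rightarrow> bool" where
  "poly_expansion x0 \<phi> P \<longleftrightarrow>
     (\<forall>N. poly_bound x0 N (\<lambda>x u. \<phi> x u - (\<Sum>k<N. poly (P k) u * of_real x ^ k)))"

lemma poly_bound_add:
  assumes "poly_bound x0 N r" "poly_bound x0 N s"
  shows "poly_bound x0 N (\<lambda>x u. r x u + s x u)"
proof -
  obtain C M where C: "0 \<le> C" "\<And>x u. 0 < x \<Longrightarrow> x \<le> x0 \<Longrightarrow> 0 \<le> Re u \<Longrightarrow> cmod (r x u) \<le> C * (1 + cmod u) ^ M * x ^ N"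
    using assms(1) unfolding poly_bound_def by blast
  obtain C' M' where C': "0 \<le> C'" "\<And>x u. 0 < x \<Longrightarrow> x \<le> x0 \<Longrightarrow> 0 \<le> Re u \<Longrightarrow> cmod (s x u) \<le> C' * (1 + cmod u) ^ M' * x ^ N"
    using assms(2) unfolding poly_bound_def by blast
  have "cmod (r x u + s x u) \<le> (C + C') * (1 + cmod u) ^ (max M M') * x ^ N"
    if "0 < x" "x \<le> x0" "0 \<le> Re u" for x u
  proof -
    have "cmod (r x u + s x u) \<le> C * (1 + cmod u) ^ M * x ^ N + C' * (1 + cmod u) ^ M' * x ^ N"
      using C(2)[OF that] C'(2)[OF that] norm_triangle_ineq[of "r x u" "s x u"] by linarith
    also have "\<dots> \<le> C * (1 + cmod u) ^ max M M' * x ^ N + C' * (1 + cmod u) ^ max M M' * x ^ N"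
      using that C(1) C'(1)
      by (intro add_mono mult_right_mono mult_left_mono power_increasing) auto
    finally show ?thesis by (simp add: algebra_simps)
  qed
  then show ?thesis
    unfolding poly_bound_def using C(1) C'(1)
    by (intro exI[of _ "C + C'"] exI[of _ "max M M'"]) auto
qed

lemma poly_bound_mult:
  assumes "poly_bound x0 N r" "poly_bound x0 N' s"
  shows "poly_bound x0 (N + N') (\<lambda>x u. r x u * s x u)"
proof -
  obtain C M where C: "0 \<le> C" "\<And>x u. 0 < x \<Longrightarrow> x \<le> x0 \<Longrightarrow> 0 \<le> Re u \<Longrightarrow> cmod (r x u) \<le> C * (1 + cmod u) ^ M * x ^ N"
    using assms(1) unfolding poly_bound_def by blast
  obtain C' M' where C': "0 \<le> C'" "\<And>x u. 0 < x \<Longrightarrow> x \<le> x0 \<Longrightarrow> 0 \<le> Re u \<Longrightarrow> cmod (s x u) \<le> C' * (1 + cmod u) ^ M' * x ^ N'"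
    using assms(2) unfolding poly_bound_def by blast
  have "cmod (r x u * s x u) \<le> (C * C') * (1 + cmod u) ^ (M + M') * x ^ (N + N')"
    if "0 < x" "x \<le> x0" "0 \<le> Re u" for x u
  proof -
    have "cmod (r x u * s x u) \<le> (C * (1 + cmod u) ^ M * x ^ N) * (C' * (1 + cmod u) ^ M' * x ^ N')"
      unfolding norm_mult using C(1) that by (intro mult_mono C(2) C'(2)) auto
    then show ?thesis by (simp add: power_add algebra_simps)
  qed
  then show ?thesis
    unfolding poly_bound_def using C(1) C'(1)
    by (intro exI[of _ "C * C'"] exI[of _ "M + M'"]) auto
qed

lemma poly_bound_zero: "poly_bound x0 N (\<lambda>x u. 0)"
  unfolding poly_bound_def by (intro exI[of _ 0]) auto

lemma poly_bound_sum:
  "(\<And>i. i \<in> A \<Longrightarrow> poly_bound x0 N (r i)) \<Longrightarrow> poly_bound x0 N (\<lambda>x u. \<Sum>i\<in>A. r i x u)"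
  by (induction A rule: infinite_finite_induct) (auto intro: poly_bound_zero poly_bound_add)

lemma poly_bound_power: "poly_bound x0 N (\<lambda>x u. of_real x ^ N)"
  unfolding poly_bound_def by (intro exI[of _ 1] exI[of _ 0]) (auto simp: norm_power)

lemma poly_bound_const: "poly_bound x0 0 (\<lambda>x u. c)"
  unfolding poly_bound_def by (intro exI[of _ "cmod c"] exI[of _ 0]) auto

lemma poly_bound_poly: "poly_bound x0 0 (\<lambda>x u. poly p u)"
proof (induction p)
  case 0
  then show ?case by (simp add: poly_bound_zero)
next
  case (pCons a p)
  have "poly_bound x0 0 (\<lambda>x u. u)"
    unfolding poly_bound_def by (intro exI[of _ 1]) auto
  from poly_bound_add[OF poly_bound_const[of x0 a] poly_bound_mult[OF this pCons.IH, simplified]]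
  show ?case by simp
qed

lemma poly_expansion_bound:
  assumes "poly_expansion x0 \<phi> P"
  shows "poly_bound x0 0 \<phi>"
  using assms[unfolded poly_expansion_def, rule_format, of 0] by simp

lemma poly_expansion_const: "poly_expansion x0 (\<lambda>x u. c) (\<lambda>k. if k = 0 then [:c:] else 0)"
  unfolding poly_expansion_def
proof
  fix N
  show "poly_bound x0 N (\<lambda>x u. c - (\<Sum>k<N. poly (if k = 0 then [:c:] else 0) u * of_real x ^ k))"
  proof (cases N)
    case 0
    then show ?thesis by (simp add: poly_bound_const)
  next
    case (Suc n)
    have "(\<Sum>k<N. poly (if k = 0 then [:c:] else 0) u * of_real x ^ k) = c" for u and x :: real
      unfolding Suc lessThan_Suc_atMost by (subst sum.atMost_shift) simp
    then show ?thesis by (simp add: poly_bound_zero)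
  qed
qed

lemma poly_expansion_add:
  assumes "poly_expansion x0 \<phi> P" "poly_expansion x0 \<psi> Q"
  shows "poly_expansion x0 (\<lambda>x u. \<phi> x u + \<psi> x u) (\<lambda>k. P k + Q k)"
  unfolding poly_expansion_def
proof
  fix N
  have "poly_bound x0 N (\<lambda>x u. (\<phi> x u - (\<Sum>k<N. poly (P k) u * of_real x ^ k)) + (\<psi> x u - (\<Sum>k<N. poly (Q k) u * of_real x ^ k)))"
    using assms by (intro poly_bound_add) (auto simp: poly_expansion_def)
  then show "poly_bound x0 N (\<lambda>x u. \<phi> x u + \<psi> x u - (\<Sum>k<N. poly (P k + Q k) u * of_real x ^ k))"
    by (simp add: algebra_simps sum.distrib)
qed

text \<open>Cauchy product. The remainder is the sum over i < N of the i-th term of \<phi> times the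
  remainder of \<psi> truncated at N - i, plus the N-th remainder of \<phi> times \<psi>. With
  \<psi> truncated at a length depending on i, every piece has order exactly N and no surplus
  products arise.\<close>

lemma poly_expansion_mult:
  assumes "poly_expansion x0 \<phi> P" "poly_expansion x0 \<psi> Q"
  shows "poly_expansion x0 (\<lambda>x u. \<phi> x u * \<psi> x u) (\<lambda>k. \<Sum>i\<le>k. P i * Q (k - i))"
  unfolding poly_expansion_def
proof
  fix N
  let ?p = "\<lambda>i x u. poly (P i) u * of_real x ^ i" and ?q = "\<lambda>i x u. poly (Q i) u * of_real x ^ i"
  have "poly_bound x0 (i + (N - i)) (\<lambda>x u. ?p i x u * (\<psi> x u - (\<Sum>j<N-i. ?q j x u)))" if "i < N" for i
    using assms(2) poly_bound_mult[OF poly_bound_poly[of x0 "P i"] poly_bound_power[of x0 i]]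
    by (intro poly_bound_mult) (auto simp: poly_expansion_def)
  then have "poly_bound x0 N (\<lambda>x u. \<Sum>i<N. ?p i x u * (\<psi> x u - (\<Sum>j<N-i. ?q j x u)))"
    by (intro poly_bound_sum) auto
  moreover have "poly_bound x0 (N + 0) (\<lambda>x u. (\<phi> x u - (\<Sum>i<N. ?p i x u)) * \<psi> x u)"
    using assms by (intro poly_bound_mult poly_expansion_bound) (auto simp: poly_expansion_def)
  ultimately have "poly_bound x0 N (\<lambda>x u. (\<Sum>i<N. ?p i x u * (\<psi> x u - (\<Sum>j<N-i. ?q j x u))) + (\<phi> x u - (\<Sum>i<N. ?p i x u)) * \<psi> x u)"
    by (intro poly_bound_add) auto
  moreover have "(\<Sum>i<N. ?p i x u * (\<psi> x u - (\<Sum>j<N-i. ?q j x u))) + (\<phi> x u - (\<Sum>i<N. ?p i x u)) * \<psi> x u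
     = \<phi> x u * \<psi> x u - (\<Sum>k<N. poly (\<Sum>i\<le>k. P i * Q (k - i)) u * of_real x ^ k)" for x :: real and u
  proof -
    have "(\<Sum>k<N. poly (\<Sum>i\<le>k. P i * Q (k - i)) u * of_real x ^ k) = (\<Sum>k<N. \<Sum>i\<le>k. ?p i x u * ?q (k - i) x u)"
      by (intro sum.cong refl) (auto simp: poly_sum sum_distrib_right power_add[symmetric] algebra_simps sum_distrib_left intro!: sum.cong)
    also have "\<dots> = (\<Sum>(i,j)\<in>{(i,j). i + j < N}. ?p i x u * ?q j x u)"
      by (rule sum.triangle_reindex[symmetric])
    also have "{(i,j). i + j < N} = Sigma {..<N} (\<lambda>i. {..<N-i})" by auto
    also have "(\<Sum>(i,j)\<in>Sigma {..<N} (\<lambda>i. {..<N-i}). ?p i x u * ?q j x u) = (\<Sum>i<N. ?p i x u * (\<Sum>j<N-i. ?q j x u))"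
      by (subst sum.Sigma[symmetric]) (auto simp: sum_distrib_left)
    finally show ?thesis
      by (simp add: algebra_simps sum_subtractf sum_distrib_left sum_distrib_right)
  qed
  ultimately show "poly_bound x0 N (\<lambda>x u. \<phi> x u * \<psi> x u - (\<Sum>k<N. poly (\<Sum>i\<le>k. P i * Q (k - i)) u * of_real x ^ k))"
    by simp
qed

definition has_poly_expansion :: "real \<Rightarrow> (real \<Rightarrow> complex \<Rightarrow> complex) \<Rightarrow> bool" where
  "has_poly_expansion x0 \<phi> \<longleftrightarrow> (\<exists>P. poly_expansion x0 \<phi> P)"

lemma has_poly_expansion_const: "has_poly_expansion x0 (\<lambda>x u. c)"
  using poly_expansion_const unfolding has_poly_expansion_def by blast

lemma has_poly_expansion_add:
  "has_poly_expansion x0 \<phi> \<Longrightarrow> has_poly_expansion x0 \<psi> \<Longrightarrow> has_poly_expansion x0 (\<lambda>x u. \<phi> x u + \<psi> x u)"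
  using poly_expansion_add unfolding has_poly_expansion_def by blast

lemma has_poly_expansion_mult:
  "has_poly_expansion x0 \<phi> \<Longrightarrow> has_poly_expansion x0 \<psi> \<Longrightarrow> has_poly_expansion x0 (\<lambda>x u. \<phi> x u * \<psi> x u)"
  using poly_expansion_mult unfolding has_poly_expansion_def by blast

lemma has_poly_expansion_power:
  "has_poly_expansion x0 \<phi> \<Longrightarrow> has_poly_expansion x0 (\<lambda>x u. \<phi> x u ^ n)"
  by (induction n) (auto intro: has_poly_expansion_const has_poly_expansion_mult)

lemma has_poly_expansion_sum:
  "(\<And>i. i \<in> A \<Longrightarrow> has_poly_expansion x0 (\<phi> i)) \<Longrightarrow> has_poly_expansion x0 (\<lambda>x u. \<Sum>i\<in>A. \<phi> i x u)"
  by (induction A rule: infinite_finite_induct)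
     (auto intro: has_poly_expansion_const has_poly_expansion_add)

lemma has_poly_expansion_prod:
  "(\<And>i. i \<in> A \<Longrightarrow> has_poly_expansion x0 (\<phi> i)) \<Longrightarrow> has_poly_expansion x0 (\<lambda>x u. \<Prod>i\<in>A. \<phi> i x u)"
  by (induction A rule: infinite_finite_induct)
     (auto intro: has_poly_expansion_const has_poly_expansion_mult)

lemma has_poly_expansion_id: "has_poly_expansion x0 (\<lambda>x u. of_real x)"
  unfolding has_poly_expansion_def poly_expansion_def
proof (intro exI allI)
  fix N
  let ?P = "\<lambda>k. if k = 1 then [:1:] else 0 :: complex poly"
  show "poly_bound x0 N (\<lambda>x u. of_real x - (\<Sum>k<N. poly (?P k) u * of_real x ^ k))"
  proof (cases "N \<le> 1")
    case True
    have "(\<Sum>k<N. poly (?P k) u * of_real x ^ k) = 0" for u and x :: real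
      using True by (intro sum.neutral) auto
    moreover have "poly_bound x0 0 (\<lambda>x u. of_real x)"
      unfolding poly_bound_def by (intro exI[of _ "\<bar>x0\<bar>"] exI[of _ 0]) auto
    moreover have "poly_bound x0 1 (\<lambda>x u. of_real x)"
      using poly_bound_power[of x0 1] by simp
    moreover have "N = 0 \<or> N = 1" using True by auto
    ultimately show ?thesis by auto
  next
    case False
    have "(\<Sum>k<N. poly (?P k) u * of_real x ^ k) = of_real x" for u and x :: real
    proof -
      have "(\<Sum>k<N. poly (?P k) u * of_real x ^ k) = (\<Sum>k<N. if k = 1 then of_real x else 0)"
        by (intro sum.cong) auto
      also have "\<dots> = of_real x" using False by (subst sum.delta) auto
      finally show ?thesis .
    qed
    then show ?thesis by (simp add: poly_bound_zero)
  qed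
qed

text \<open>The real shift \<kappa> x has size at most 1/2 and u x has nonnegative real part. The
  bound is therefore uniform in u, including where u x is large.\<close>

lemma Re_one_plus_mult_ge:
  assumes "0 < x" "x \<le> x0" "x0 * \<bar>\<kappa>\<bar> \<le> 1/2" "0 \<le> Re u"
  shows "Re (1 + (of_real \<kappa> + u) * of_real x) \<ge> 1/2"
proof -
  have "x * \<bar>\<kappa>\<bar> \<le> x0 * \<bar>\<kappa>\<bar>" using assms by (intro mult_right_mono) auto
  then have "\<bar>\<kappa> * x\<bar> \<le> 1/2" using assms by (simp add: abs_mult mult.commute)
  moreover have "Re u * x \<ge> 0" using assms by simp
  ultimately show ?thesis by (simp add: algebra_simps)
qed

text \<open>With v = (\<kappa> + u) x, the geometric sum of powers of -v misses 1 / (1 + v) by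
  exactly (-v)^N / (1 + v). Since |1 + v| >= 1/2, this is at most 2 |v|^N even when v is large, and
  |v| is at most linear in |u| times x.\<close>

lemma has_poly_expansion_inverse:
  assumes "x0 * \<bar>\<kappa>\<bar> \<le> 1/2"
  shows "has_poly_expansion x0 (\<lambda>x u. inverse (1 + (of_real \<kappa> + u) * of_real x))"
  unfolding has_poly_expansion_def poly_expansion_def
proof (intro exI allI)
  fix N
  let ?P = "\<lambda>k. [:- of_real \<kappa>, -1:] ^ k :: complex poly"
  have *: "cmod (inverse (1 + (of_real \<kappa> + u) * of_real x) - (\<Sum>k<N. poly (?P k) u * of_real x ^ k))
       \<le> 2 * (1 + \<bar>\<kappa>\<bar>) ^ N * (1 + cmod u) ^ N * x ^ N"
    if x: "0 < x" "x \<le> x0" "0 \<le> Re u" for x u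
  proof -
    define v where "v = (of_real \<kappa> + u) * of_real x"
    have half: "Re (1 + v) \<ge> 1/2"
      unfolding v_def by (rule Re_one_plus_mult_ge[OF x(1,2) assms x(3)])
    then have nz: "1 + v \<noteq> 0" by (metis zero_complex.sel(1) zero_less_divide_1_iff zero_less_numeral not_le)
    have "(\<Sum>k<N. poly (?P k) u * of_real x ^ k) = (\<Sum>k<N. (- v) ^ k)"
      by (intro sum.cong refl) (simp add: v_def power_mult_distrib[symmetric] algebra_simps)
    also have "\<dots> = (1 - (- v) ^ N) / (1 + v)"
    proof -
      have "- v \<noteq> 1" using nz by (metis add.left_inverse)
      then show ?thesis
        using nz geometric_sum[of "- v" N] by (simp add: field_simps)
    qed
    finally have "inverse (1 + v) - (\<Sum>k<N. poly (?P k) u * of_real x ^ k) = (- v) ^ N / (1 + v)"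
      by (simp add: inverse_eq_divide diff_divide_distrib)
    then have "cmod (inverse (1 + v) - (\<Sum>k<N. poly (?P k) u * of_real x ^ k)) = cmod v ^ N / cmod (1 + v)"
      by (simp add: norm_divide norm_power)
    also have "\<dots> \<le> cmod v ^ N / (1/2)"
      using half complex_Re_le_cmod[of "1 + v"] by (intro divide_left_mono) auto
    finally have 1: "cmod (inverse (1 + v) - (\<Sum>k<N. poly (?P k) u * of_real x ^ k)) \<le> 2 * cmod v ^ N" by simp
    have "cmod v \<le> (1 + \<bar>\<kappa>\<bar>) * (1 + cmod u) * x"
    proof -
      have "cmod (of_real \<kappa> + u) \<le> \<bar>\<kappa>\<bar> + cmod u"
        by (metis norm_of_real norm_triangle_ineq)
      also have "\<dots> \<le> (1 + \<bar>\<kappa>\<bar>) * (1 + cmod u)" by (simp add: algebra_simps)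
      finally show ?thesis using x by (simp add: v_def norm_mult mult_right_mono)
    qed
    then have "cmod v ^ N \<le> ((1 + \<bar>\<kappa>\<bar>) * (1 + cmod u) * x) ^ N"
      by (intro power_mono) auto
    with 1 show ?thesis
      unfolding v_def power_mult_distrib by linarith
  qed
  show "poly_bound x0 N (\<lambda>x u. inverse (1 + (of_real \<kappa> + u) * of_real x) - (\<Sum>k<N. poly (?P k) u * of_real x ^ k))"
    unfolding poly_bound_def
    by (rule exI[of _ "2 * (1 + \<bar>\<kappa>\<bar>) ^ N"], rule exI[of _ N]) (use * in auto)
qed

text \<open>The coefficients are the integrals of w against the polynomials \<open>P k\<close>.
  Since w has finite moments of every order in |\<open>\<l>\<close>|, the polynomial growth of the
  remainder is integrated away and a pure power x^N is left.\<close>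

lemma integral_poly_expansion:
  fixes w \<l> :: "real \<Rightarrow> complex"
  assumes ex: "has_poly_expansion x0 \<phi>"
    and [measurable]: "w \<in> borel_measurable borel" "\<l> \<in> borel_measurable borel"
    and meas: "\<And>x. 0 < x \<Longrightarrow> x \<le> x0 \<Longrightarrow> (\<lambda>y. \<phi> x (\<l> y)) \<in> borel_measurable borel"
    and l: "\<And>y. Re (\<l> y) \<ge> 0"
    and int: "\<And>M. integrable lborel (\<lambda>y. cmod (w y) * (1 + cmod (\<l> y)) ^ M)"
  shows "\<exists>c :: nat \<Rightarrow> complex. \<forall>N. \<exists>C. \<forall>x. 0 < x \<and> x \<le> x0 \<longrightarrow>
     cmod ((\<integral>y. w y * \<phi> x (\<l> y) \<partial>lborel) - (\<Sum>k<N. c k * of_real x ^ k)) \<le> C * x ^ N"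
proof -
  obtain P where P: "poly_expansion x0 \<phi> P" using ex unfolding has_poly_expansion_def by blast
  have intb: "integrable lborel (\<lambda>y. w y * r x (\<l> y))"
      if r: "poly_bound x0 0 r" and x: "0 < x" "x \<le> x0" and [measurable]: "(\<lambda>y. r x (\<l> y)) \<in> borel_measurable borel" for r x
  proof -
    obtain C M where C: "0 \<le> C" "\<And>x u. 0 < x \<Longrightarrow> x \<le> x0 \<Longrightarrow> 0 \<le> Re u \<Longrightarrow> cmod (r x u) \<le> C * (1 + cmod u) ^ M * x ^ 0"
      using r unfolding poly_bound_def by blast
    show ?thesis
    proof (rule Bochner_Integration.integrable_bound)
      show "integrable lborel (\<lambda>y. C * (cmod (w y) * (1 + cmod (\<l> y)) ^ M))"
        by (intro integrable_mult_right int)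
      show "AE y in lborel. norm (w y * r x (\<l> y)) \<le> norm (C * (cmod (w y) * (1 + cmod (\<l> y)) ^ M))"
      proof (rule AE_I2)
        fix y
        have "cmod (w y) * cmod (r x (\<l> y)) \<le> cmod (w y) * (C * (1 + cmod (\<l> y)) ^ M)"
          using C(2)[OF x l[of y]] by (intro mult_left_mono) auto
        then show "norm (w y * r x (\<l> y)) \<le> norm (C * (cmod (w y) * (1 + cmod (\<l> y)) ^ M))"
          using C(1) by (simp add: norm_mult abs_mult norm_power algebra_simps)
      qed
    qed measurable
  qed
  have mp [measurable]: "(\<lambda>y. poly p (\<l> y)) \<in> borel_measurable borel" for p
    by (rule borel_measurable_continuous_on[OF _ assms(3)]) (intro continuous_intros)
  \<comment> \<open>\<open>poly_bound\<close> says nothing when the range of x is empty, so x = x0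
    is taken as an admissible point.\<close>
  have intp: "integrable lborel (\<lambda>y. w y * poly p (\<l> y))" if "0 < x0" for p
    using intb[OF poly_bound_poly[of x0 p], of x0] that by simp
  show ?thesis
  proof (intro exI[of _ "\<lambda>k. \<integral>y. w y * poly (P k) (\<l> y) \<partial>lborel"] allI)
    fix N
    obtain C M where C: "0 \<le> C" "\<And>x u. 0 < x \<Longrightarrow> x \<le> x0 \<Longrightarrow> 0 \<le> Re u \<Longrightarrow>
        cmod (\<phi> x u - (\<Sum>k<N. poly (P k) u * of_real x ^ k)) \<le> C * (1 + cmod u) ^ M * x ^ N"
      using P unfolding poly_expansion_def poly_bound_def by blast
    define W where "W = (\<integral>y. cmod (w y) * (1 + cmod (\<l> y)) ^ M \<partial>lborel)"
    have "cmod ((\<integral>y. w y * \<phi> x (\<l> y) \<partial>lborel) - (\<Sum>k<N. (\<integral>y. w y * poly (P k) (\<l> y) \<partial>lborel) * of_real x ^ k)) \<le> (C * W) * x ^ N"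
      if x: "0 < x" "x \<le> x0" for x
    proof -
      have x0: "0 < x0" using x by simp
      note i1 = intb[OF poly_expansion_bound[OF P] x meas[OF x]]
      have i2: "integrable lborel (\<lambda>y. w y * poly (P k) (\<l> y) * of_real x ^ k)" for k
        by (intro integrable_mult_left intp x0)
      have "(\<integral>y. w y * \<phi> x (\<l> y) \<partial>lborel) - (\<Sum>k<N. (\<integral>y. w y * poly (P k) (\<l> y) \<partial>lborel) * of_real x ^ k)
        = (\<integral>y. w y * \<phi> x (\<l> y) \<partial>lborel) - (\<Sum>k<N. (\<integral>y. w y * poly (P k) (\<l> y) * of_real x ^ k \<partial>lborel))"
        by (simp add: intp x0)
      also have "\<dots> = (\<integral>y. w y * \<phi> x (\<l> y) - (\<Sum>k<N. w y * poly (P k) (\<l> y) * of_real x ^ k) \<partial>lborel)"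
        by (simp add: i1 i2)
      also have "cmod \<dots> \<le> (\<integral>y. (C * x ^ N) * (cmod (w y) * (1 + cmod (\<l> y)) ^ M) \<partial>lborel)"
      proof (rule order_trans[OF integral_norm_bound integral_mono])
        fix y
        have "w y * \<phi> x (\<l> y) - (\<Sum>k<N. w y * poly (P k) (\<l> y) * of_real x ^ k)
           = w y * (\<phi> x (\<l> y) - (\<Sum>k<N. poly (P k) (\<l> y) * of_real x ^ k))"
          by (simp add: algebra_simps sum_distrib_left)
        also have "cmod \<dots> \<le> cmod (w y) * (C * (1 + cmod (\<l> y)) ^ M * x ^ N)"
          unfolding norm_mult by (intro mult_left_mono C x l) auto
        finally show "cmod (w y * \<phi> x (\<l> y) - (\<Sum>k<N. w y * poly (P k) (\<l> y) * of_real x ^ k))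
           \<le> (C * x ^ N) * (cmod (w y) * (1 + cmod (\<l> y)) ^ M)"
          by (simp add: algebra_simps)
      qed (use i1 i2 int in auto)
      also have "\<dots> = (C * W) * x ^ N" by (simp add: W_def)
      finally show ?thesis .
    qed
    then show "\<exists>C. \<forall>x. 0 < x \<and> x \<le> x0 \<longrightarrow> cmod ((\<integral>y. w y * \<phi> x (\<l> y) \<partial>lborel)
       - (\<Sum>k<N. (\<integral>y. w y * poly (P k) (\<l> y) \<partial>lborel) * of_real x ^ k)) \<le> C * x ^ N"
      by blast
  qed
qed

section \<open>Integrability along the line Re s = 1\<close>

lemma integrable_powr_tail:
  "integrable lborel (\<lambda>y::real. indicator {1..} y * y powr (-3/2))"
proof -
  have "((\<lambda>x. x powr (-3/2)) has_integral -(1 powr (-3/2 + 1)) / (-3/2 + 1)) {1::real..}"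
    by (rule has_integral_powr_to_inf) auto
  then have "(\<lambda>x. x powr (-3/2)) absolutely_integrable_on {1::real..}"
    by (intro nonnegative_absolutely_integrable_1) (auto simp: integrable_on_def)
  then have "integrable lebesgue (\<lambda>y::real. indicator {1..} y * y powr (-3/2))"
    by (simp add: set_integrable_def)
  then show ?thesis
    by (subst (asm) integrable_completion) auto
qed

lemma norm_Complex_1_ge: "cmod (Complex 1 y) \<ge> 1" "cmod (Complex 1 y) \<ge> \<bar>y\<bar>"
  using abs_Re_le_cmod[of "Complex 1 y"] abs_Im_le_cmod[of "Complex 1 y"] by auto

text \<open>The exponent is the -2 of the weight plus the 1/2 that powers of the logarithm may cost;
  it is still below -1. On the two tails |1 + i y| >= |y| reduces the claim to a real power.\<close>

lemma integrable_norm_Complex_powr: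
  "integrable lborel (\<lambda>y. cmod (Complex 1 y) powr (-3/2))"
proof (rule Bochner_Integration.integrable_bound)
  let ?f = "\<lambda>y::real. indicator {1..} y * y powr (-3/2)"
  have "integrable lborel (\<lambda>y. ?f (0 + (-1) * y))"
    by (rule lborel_integrable_real_affine[OF integrable_powr_tail]) auto
  then have "integrable lborel (\<lambda>y. ?f (- y))" by simp
  moreover have "integrable lborel (indicator {-1..1} :: real \<Rightarrow> real)"
    by (auto simp: integrable_indicator_iff)
  ultimately show "integrable lborel (\<lambda>y. indicator {-1..1} y + ?f y + ?f (- y))"
    using integrable_powr_tail by (intro Bochner_Integration.integrable_add)
  have "continuous_on UNIV (\<lambda>y. cmod (Complex 1 y) powr (-3/2))"
    by (intro continuous_intros continuous_on_Complex) (simp add: complex_eq_iff)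
  then show "(\<lambda>y. cmod (Complex 1 y) powr (-3/2)) \<in> borel_measurable lborel"
    by (simp add: borel_measurable_continuous_onI)
  show "AE y in lborel. norm (cmod (Complex 1 y) powr (-3/2)) \<le> norm (indicator {-1..1} y + ?f y + ?f (- y))"
  proof (rule AE_I2)
    fix y :: real
    consider "\<bar>y\<bar> \<le> 1" | "y > 1" | "y < -1" by linarith
    then show "norm (cmod (Complex 1 y) powr (-3/2)) \<le> norm (indicator {-1..1} y + ?f y + ?f (- y))"
    proof cases
      case 1
      have "cmod (Complex 1 y) powr (-3/2) \<le> 1 powr (-3/2)"
        by (rule powr_mono2') (use norm_Complex_1_ge[of y] in auto)
      then show ?thesis using 1 by (auto simp: indicator_def)
    next
      case 2
      have "cmod (Complex 1 y) powr (-3/2) \<le> \<bar>y\<bar> powr (-3/2)"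
        by (rule powr_mono2') (use norm_Complex_1_ge[of y] 2 in auto)
      then show ?thesis using 2 by (auto simp: indicator_def)
    next
      case 3
      have "cmod (Complex 1 y) powr (-3/2) \<le> \<bar>y\<bar> powr (-3/2)"
        by (rule powr_mono2') (use norm_Complex_1_ge[of y] 3 in auto)
      then show ?thesis using 3 by (auto simp: indicator_def)
    qed
  qed
qed

text \<open>The expansions are uniform only for Re u >= 0; this admits u = Ln s on the whole line Re
  s = 1, because |s| >= 1 there.\<close>

lemma Re_Ln_Complex_1_ge: "Re (Ln (Complex 1 y)) \<ge> 0"
proof -
  have "Complex 1 y \<noteq> 0" by (simp add: complex_eq_iff)
  then show ?thesis using norm_Complex_1_ge[of y] by simp
qed

lemma log_power_bound:
  "\<exists>C>0. \<forall>y. (1 + cmod (Ln (Complex 1 y))) ^ M \<le> C * cmod (Complex 1 y) powr (1/2)"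
proof (intro exI conjI allI)
  \<comment> \<open>The logarithm is bounded by |s|^e up to a constant, and e is chosen so that the
    M-th power costs at most |s|^(1/2). The added 1 keeps e positive when M = 0.\<close>
  define e :: real where "e = 1 / (2 * (real M + 1))"
  have e: "e > 0" "e * real M \<le> 1/2" by (auto simp: e_def field_simps)
  show "(1 + pi + 1/e) ^ M > 0" using e by (simp add: add_pos_pos)
  fix y
  define r where "r = cmod (Complex 1 y)"
  have r: "r \<ge> 1" using norm_Complex_1_ge by (simp add: r_def)
  have nz: "Complex 1 y \<noteq> 0" by (simp add: complex_eq_iff)
  have "cmod (Ln (Complex 1 y)) \<le> \<bar>Re (Ln (Complex 1 y))\<bar> + \<bar>Im (Ln (Complex 1 y))\<bar>"
    by (rule cmod_le)
  also have "\<dots> \<le> ln r + pi"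
    using Im_Ln_le_pi[OF nz] mpi_less_Im_Ln[OF nz] r nz by (auto simp: r_def[symmetric])
  also have "ln r \<le> r powr e / e" by (rule ln_powr_bound[OF r e(1)])
  finally have "1 + cmod (Ln (Complex 1 y)) \<le> (1 + pi) * 1 + r powr e / e" by simp
  also have "\<dots> \<le> (1 + pi) * r powr e + r powr e / e"
    using r e pi_gt_zero by (intro add_right_mono mult_left_mono) (auto simp: ge_one_powr_ge_zero)
  also have "\<dots> = (1 + pi + 1/e) * r powr e" by (simp add: algebra_simps)
  finally have "(1 + cmod (Ln (Complex 1 y))) ^ M \<le> ((1 + pi + 1/e) * r powr e) ^ M"
    by (intro power_mono) auto
  also have "\<dots> = (1 + pi + 1/e) ^ M * r powr (e * real M)"
    using r by (simp add: power_mult_distrib powr_powr powr_realpow[symmetric])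
  also have "\<dots> \<le> (1 + pi + 1/e) ^ M * r powr (1/2)"
    using r e pi_gt_zero by (intro mult_left_mono powr_mono) auto
  finally show "(1 + cmod (Ln (Complex 1 y))) ^ M \<le> (1 + pi + 1/e) ^ M * cmod (Complex 1 y) powr (1/2)"
    by (simp add: r_def)
qed

lemma borel_measurable_Ln_Complex_1 [measurable]: "(\<lambda>y. Ln (Complex 1 y)) \<in> borel_measurable borel"
  by (intro borel_measurable_continuous_onI continuous_intros continuous_on_Complex)
     (auto simp: complex_nonpos_Reals_iff complex_eq_iff)

lemma integrable_weight:
  assumes w: "\<And>y. cmod (w y) \<le> K * cmod (Complex 1 y) powr (-2)"
    and [measurable]: "w \<in> borel_measurable borel"
  shows "integrable lborel (\<lambda>y. cmod (w y) * (1 + cmod (Ln (Complex 1 y))) ^ M)"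
proof -
  obtain C where C: "C > 0" "\<And>y. (1 + cmod (Ln (Complex 1 y))) ^ M \<le> C * cmod (Complex 1 y) powr (1/2)"
    using log_power_bound by blast
  show ?thesis
  proof (rule Bochner_Integration.integrable_bound)
    show "integrable lborel (\<lambda>y. K * C * cmod (Complex 1 y) powr (-3/2))"
      by (intro integrable_mult_right integrable_norm_Complex_powr)
    show "AE y in lborel. norm (cmod (w y) * (1 + cmod (Ln (Complex 1 y))) ^ M) \<le> norm (K * C * cmod (Complex 1 y) powr (-3/2))"
    proof (rule AE_I2)
      fix y
      have "cmod (w y) * (1 + cmod (Ln (Complex 1 y))) ^ M \<le> (K * cmod (Complex 1 y) powr (-2)) * (C * cmod (Complex 1 y) powr (1/2))"
        by (intro mult_mono w C order_trans[OF norm_ge_zero w]) auto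
      also have "\<dots> = K * C * (cmod (Complex 1 y) powr (-2) * cmod (Complex 1 y) powr (1/2))"
        by simp
      also have "cmod (Complex 1 y) powr (-2) * cmod (Complex 1 y) powr (1/2) = cmod (Complex 1 y) powr (-3/2)"
        by (simp add: powr_add[symmetric])
      finally show "norm (cmod (w y) * (1 + cmod (Ln (Complex 1 y))) ^ M) \<le> norm (K * C * cmod (Complex 1 y) powr (-3/2))"
        by simp
    qed
  qed measurable
qed

section \<open>The symbol and its derivatives\<close>

text \<open>A rational function of w = Ln z. The index set is a parameter so that indices with
  \<alpha> k = 0, which create no pole, can be left out.\<close>

definition log_prod :: "(nat \<Rightarrow> real) \<Rightarrow> (nat \<Rightarrow> nat) \<Rightarrow> nat set \<Rightarrow> complex \<Rightarrow> complex" where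
  "log_prod \<kappa> \<alpha> A w = (\<Prod>k\<in>A. inverse (w + of_real (\<kappa> k)) ^ \<alpha> k)"

text \<open>For n = 1 this is minus the logarithmic derivative of \<open>log_prod\<close>; for n = 2
  it is minus the derivative of the case n = 1.\<close>

definition log_sum :: "nat \<Rightarrow> (nat \<Rightarrow> real) \<Rightarrow> (nat \<Rightarrow> nat) \<Rightarrow> nat set \<Rightarrow> complex \<Rightarrow> complex" where
  "log_sum n \<kappa> \<alpha> A w = (\<Sum>k\<in>A. of_nat (\<alpha> k) * inverse (w + of_real (\<kappa> k)) ^ n)"

lemma log_prod_deriv:
  assumes "finite A" "\<And>k. k \<in> A \<Longrightarrow> w + of_real (\<kappa> k) \<noteq> 0"
  shows "(log_prod \<kappa> \<alpha> A has_field_derivative - (log_prod \<kappa> \<alpha> A w * log_sum 1 \<kappa> \<alpha> A w)) (at w)"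
  using assms
proof (induction A)
  case empty
  then show ?case by (simp add: log_prod_def log_sum_def)
next
  case (insert j A)
  have eq: "log_prod \<kappa> \<alpha> (insert j A) = (\<lambda>w. inverse (w + of_real (\<kappa> j)) ^ \<alpha> j * log_prod \<kappa> \<alpha> A w)"
    using insert.hyps by (simp add: log_prod_def fun_eq_iff)
  have nz: "w + of_real (\<kappa> j) \<noteq> 0" using insert.prems by simp
  have ih: "(log_prod \<kappa> \<alpha> A has_field_derivative - (log_prod \<kappa> \<alpha> A w * log_sum 1 \<kappa> \<alpha> A w)) (at w)"
    using insert by simp
  have "((\<lambda>w. inverse (w + of_real (\<kappa> j)) ^ n) has_field_derivative
      - (of_nat n * inverse (w + of_real (\<kappa> j)) ^ n * inverse (w + of_real (\<kappa> j)))) (at w)" for n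
  proof -
    have "((\<lambda>w. inverse (w + of_real (\<kappa> j))) has_field_derivative
       - (inverse (w + of_real (\<kappa> j)) * inverse (w + of_real (\<kappa> j)))) (at w)"
      using nz by (auto intro!: derivative_eq_intros)
    from DERIV_power[OF this, of n] show ?thesis
      by (rule DERIV_cong) (cases n; simp)
  qed
  from DERIV_mult[OF this[of "\<alpha> j"] ih] show ?case
    unfolding eq by (rule DERIV_cong) (use insert.hyps in \<open>simp add: log_sum_def algebra_simps\<close>)
qed

lemma log_sum_deriv:
  assumes "\<And>k. k \<in> A \<Longrightarrow> w + of_real (\<kappa> k) \<noteq> 0"
  shows "(log_sum 1 \<kappa> \<alpha> A has_field_derivative - log_sum 2 \<kappa> \<alpha> A w) (at w)"
proof -
  have "((\<lambda>w. \<Sum>k\<in>A. of_nat (\<alpha> k) * inverse (w + of_real (\<kappa> k))) has_field_derivative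
      (\<Sum>k\<in>A. of_nat (\<alpha> k) * - (inverse (w + of_real (\<kappa> k)) ^ 2))) (at w)"
    by (intro DERIV_sum DERIV_cmult)
       (use assms in \<open>auto intro!: derivative_eq_intros simp: field_simps power2_eq_square\<close>)
  then show ?thesis
    by (simp add: log_sum_def[abs_def] sum_negf)
qed

text \<open>This is z^2 times the second z-derivative of the symbol, stripped of z^(-\<nu>) and read
  in w = Ln z. With S1 and S2 for the two \<open>log_sum\<close> terms, the bracket equals (\<nu> +
  S1) (\<nu> + S1 + 1) + S2.\<close>

definition log_kernel :: "(nat \<Rightarrow> real) \<Rightarrow> (nat \<Rightarrow> nat) \<Rightarrow> nat set \<Rightarrow> real \<Rightarrow> complex \<Rightarrow> complex" where
  "log_kernel \<kappa> \<alpha> A \<nu> w = log_prod \<kappa> \<alpha> A w *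
     (of_real (\<nu> * (\<nu> + 1)) + of_real (2 * \<nu> + 1) * log_sum 1 \<kappa> \<alpha> A w
      + log_sum 1 \<kappa> \<alpha> A w ^ 2 + log_sum 2 \<kappa> \<alpha> A w)"

definition symbol :: "(nat \<Rightarrow> real) \<Rightarrow> (nat \<Rightarrow> nat) \<Rightarrow> nat set \<Rightarrow> real \<Rightarrow> complex \<Rightarrow> complex" where
  "symbol \<kappa> \<alpha> A \<nu> z = z powr (- of_real \<nu>) * log_prod \<kappa> \<alpha> A (Ln z)"

definition symbol' :: "(nat \<Rightarrow> real) \<Rightarrow> (nat \<Rightarrow> nat) \<Rightarrow> nat set \<Rightarrow> real \<Rightarrow> complex \<Rightarrow> complex" where
  "symbol' \<kappa> \<alpha> A \<nu> z = z powr (- of_real \<nu> - 1) *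
     - (log_prod \<kappa> \<alpha> A (Ln z) * (of_real \<nu> + log_sum 1 \<kappa> \<alpha> A (Ln z)))"

definition symbol'' :: "(nat \<Rightarrow> real) \<Rightarrow> (nat \<Rightarrow> nat) \<Rightarrow> nat set \<Rightarrow> real \<Rightarrow> complex \<Rightarrow> complex" where
  "symbol'' \<kappa> \<alpha> A \<nu> z = z powr (- of_real \<nu> - 2) * log_kernel \<kappa> \<alpha> A \<nu> (Ln z)"

lemma symbol_deriv:
  assumes "finite A" "z \<notin> \<real>\<^sub>\<le>\<^sub>0" "\<And>k. k \<in> A \<Longrightarrow> Ln z + of_real (\<kappa> k) \<noteq> 0"
  shows "(symbol \<kappa> \<alpha> A \<nu> has_field_derivative symbol' \<kappa> \<alpha> A \<nu> z) (at z)"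
    and "(symbol' \<kappa> \<alpha> A \<nu> has_field_derivative symbol'' \<kappa> \<alpha> A \<nu> z) (at z)"
proof -
  have nz: "z \<noteq> 0" using assms(2) by auto
  have G: "((\<lambda>z. log_prod \<kappa> \<alpha> A (Ln z)) has_field_derivative
      - (log_prod \<kappa> \<alpha> A (Ln z) * log_sum 1 \<kappa> \<alpha> A (Ln z)) * inverse z) (at z)"
    by (rule DERIV_chain2[OF log_prod_deriv has_field_derivative_Ln]) (use assms in auto)
  have S: "((\<lambda>z. log_sum 1 \<kappa> \<alpha> A (Ln z)) has_field_derivative
      - log_sum 2 \<kappa> \<alpha> A (Ln z) * inverse z) (at z)"
    by (rule DERIV_chain2[OF log_sum_deriv has_field_derivative_Ln]) (use assms in auto)
  have "z powr (s - 1) = z powr s / z" for s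
    using nz by (simp add: powr_diff)
  note p1 = this[of "- of_real \<nu>"] and p2 = this[of "- of_real \<nu> - 1"]
  have "- complex_of_real \<nu> - 2 = - of_real \<nu> - 1 - 1" by simp
  then have p3: "z powr (- of_real \<nu> - 2) = z powr (- of_real \<nu>) / z / z"
    unfolding p1[symmetric] p2[symmetric] by (rule arg_cong)
  \<comment> \<open>An opaque name for the power: the exponents lowered by 1 and 2 become quotients
    of this one atom, and only rational identities remain.\<close>
  obtain P where P: "P = z powr (- of_real \<nu>)" by blast
  note p = p1[folded P] p2[unfolded p1, folded P] p3[folded P] P[symmetric]
  have eq: "- of_real \<nu> * z powr (- of_real \<nu> - 1) * log_prod \<kappa> \<alpha> A (Ln z)
      + - (log_prod \<kappa> \<alpha> A (Ln z) * log_sum 1 \<kappa> \<alpha> A (Ln z)) * inverse z * z powr (- of_real \<nu>)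
      = symbol' \<kappa> \<alpha> A \<nu> z"
    unfolding symbol'_def p using nz by (simp add: field_simps)
  show "(symbol \<kappa> \<alpha> A \<nu> has_field_derivative symbol' \<kappa> \<alpha> A \<nu> z) (at z)"
    unfolding symbol_def[abs_def]
    by (rule DERIV_cong[OF DERIV_mult[OF has_field_derivative_powr[OF assms(2)] G] eq])
  have GS: "((\<lambda>z. - (log_prod \<kappa> \<alpha> A (Ln z) * (of_real \<nu> + log_sum 1 \<kappa> \<alpha> A (Ln z)))) has_field_derivative
     log_prod \<kappa> \<alpha> A (Ln z) * (log_sum 1 \<kappa> \<alpha> A (Ln z) * (of_real \<nu> + log_sum 1 \<kappa> \<alpha> A (Ln z)) + log_sum 2 \<kappa> \<alpha> A (Ln z)) / z) (at z)"
    by (rule DERIV_cong[OF DERIV_minus[OF DERIV_mult[OF G DERIV_add[OF DERIV_const S]]]])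
       (simp add: divide_inverse algebra_simps)
  show "(symbol' \<kappa> \<alpha> A \<nu> has_field_derivative symbol'' \<kappa> \<alpha> A \<nu> z) (at z)"
    unfolding symbol'_def[abs_def] symbol''_def
    by (rule DERIV_cong[OF DERIV_mult[OF has_field_derivative_powr[OF assms(2)] GS]],
        simp add: p nz log_kernel_def field_simps power2_eq_square)
qed

lemma symbol''_isCont:
  assumes "finite A" "z \<notin> \<real>\<^sub>\<le>\<^sub>0" "\<And>k. k \<in> A \<Longrightarrow> Ln z + of_real (\<kappa> k) \<noteq> 0"
  shows "isCont (symbol'' \<kappa> \<alpha> A \<nu>) z"
  unfolding symbol''_def[abs_def] log_kernel_def log_prod_def log_sum_def
  using assms by (intro continuous_intros) auto

text \<open>Re (Ln z) depends on |z| alone, so a neighbourhood of infinity, in every direction,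
  lands in a right half-plane of the variable w.\<close>

lemma eventually_Re_Ln_ge: "\<forall>\<^sub>F z in at_infinity. Re (Ln z) \<ge> c \<and> cmod z \<ge> 1"
  unfolding eventually_at_infinity
proof (intro exI allI impI)
  fix z :: complex assume z: "cmod z \<ge> max 1 (exp c)"
  then have "z \<noteq> 0" "ln (exp c) \<le> ln (cmod z)"
    by (auto simp del: ln_exp intro!: ln_mono)
  then show "Re (Ln z) \<ge> c \<and> cmod z \<ge> 1" using z by simp
qed

lemma norm_powr_neg: "cmod (z powr (- of_real a - of_nat n)) = cmod z powr (- a - real n)"
proof -
  have "- of_real a - of_nat n = complex_of_real (- a - real n)" by simp
  then show ?thesis
    by (metis Re_complex_of_real Reals_of_real norm_powr_real_powr')
qed

lemma norm_at_infinity_powr: "s > 0 \<Longrightarrow> ((\<lambda>z::complex. cmod z powr (- s)) \<longlongrightarrow> 0) at_infinity"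
  by (rule tendsto_neg_powr[OF _ filterlim_norm_at_top]) simp

section \<open>Bounds for Re w >= w0, where every w + \<kappa> k has real part at least 1\<close>

context
  fixes \<kappa> :: "nat \<Rightarrow> real" and \<alpha> :: "nat \<Rightarrow> nat" and A :: "nat set" and \<nu> w0 :: real
  assumes fin: "finite A" and w0: "\<And>k. k \<in> A \<Longrightarrow> w0 + \<kappa> k \<ge> 1" and w0_nonneg: "w0 \<ge> 0" and \<nu>: "\<nu> \<ge> 0"
begin

lemma norm_add_kappa_ge:
  assumes "Re w \<ge> w0" "k \<in> A"
  shows "cmod (w + of_real (\<kappa> k)) \<ge> 1"
  using complex_Re_le_cmod[of "w + of_real (\<kappa> k)"] w0[OF assms(2)] assms(1) by simp

lemma norm_inverse_add_kappa_le:
  assumes "Re w \<ge> w0" "k \<in> A"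
  shows "cmod (inverse (w + of_real (\<kappa> k))) \<le> 1"
  using norm_add_kappa_ge[OF assms] by (simp add: norm_inverse inverse_le_1_iff)

lemma add_kappa_nonzero:
  assumes "Re w \<ge> w0" "k \<in> A"
  shows "w + of_real (\<kappa> k) \<noteq> 0"
  using norm_add_kappa_ge[OF assms] by auto

lemma norm_log_prod_le:
  assumes "Re w \<ge> w0"
  shows "cmod (log_prod \<kappa> \<alpha> A w) \<le> 1"
  unfolding log_prod_def prod_norm[symmetric] norm_power
  by (intro prod_le_1 power_le_one conjI norm_inverse_add_kappa_le[OF assms]) auto

lemma norm_log_sum_le:
  assumes "Re w \<ge> w0"
  shows "cmod (log_sum n \<kappa> \<alpha> A w) \<le> real (\<Sum>k\<in>A. \<alpha> k)"
proof -
  have "cmod (of_nat (\<alpha> k) * inverse (w + of_real (\<kappa> k)) ^ n) \<le> real (\<alpha> k)" if "k \<in> A" for k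
    unfolding norm_mult norm_power norm_of_nat
    by (intro mult_left_le power_le_one norm_inverse_add_kappa_le[OF assms that]) auto
  then show ?thesis
    unfolding log_sum_def of_nat_sum by (rule sum_norm_le)
qed

text \<open>No decay is extracted from the logarithms; integrability of the second derivative comes
  from z^(-\<nu>-2) alone.\<close>

lemma log_kernel_bounded:
  "\<exists>B\<ge>0. \<forall>w. Re w \<ge> w0 \<longrightarrow> cmod (log_kernel \<kappa> \<alpha> A \<nu> w) \<le> B"
proof -
  define m where "m = real (\<Sum>k\<in>A. \<alpha> k)"
  have m: "m \<ge> 0" by (simp add: m_def sum_nonneg)
  have "cmod (log_kernel \<kappa> \<alpha> A \<nu> w) \<le> 1 * (\<nu> * (\<nu> + 1) + (2 * \<nu> + 1) * m + m ^ 2 + m)" if w: "Re w \<ge> w0" for w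
    unfolding log_kernel_def norm_mult
  proof (rule mult_mono)
    note s = norm_log_sum_le[OF w, folded m_def]
    have "cmod (of_real (2 * \<nu> + 1) * log_sum 1 \<kappa> \<alpha> A w) \<le> (2 * \<nu> + 1) * m"
      unfolding norm_mult norm_of_real using \<nu> s by (intro mult_mono) auto
    moreover have "cmod (log_sum 1 \<kappa> \<alpha> A w ^ 2) \<le> m ^ 2"
      unfolding norm_power by (intro power_mono s) auto
    moreover have "cmod (of_real (\<nu> * (\<nu> + 1))) \<le> \<nu> * (\<nu> + 1)"
      unfolding norm_of_real using \<nu> by simp
    ultimately show "cmod (of_real (\<nu> * (\<nu> + 1)) + of_real (2 * \<nu> + 1) * log_sum 1 \<kappa> \<alpha> A w
      + log_sum 1 \<kappa> \<alpha> A w ^ 2 + log_sum 2 \<kappa> \<alpha> A w) \<le> \<nu> * (\<nu> + 1) + (2 * \<nu> + 1) * m + m ^ 2 + m"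
      using s[of 2] by (intro norm_triangle_mono)
  qed (use norm_log_prod_le[OF w] in auto)
  moreover have "0 \<le> 1 * (\<nu> * (\<nu> + 1) + (2 * \<nu> + 1) * m + m ^ 2 + m)"
    using m \<nu> by simp
  ultimately show ?thesis by blast
qed

text \<open>The assumption excludes the symbol that is 1 away from the origin. Either the power
  decays, or a single factor with positive exponent decays like 1 / log |z| while all other factors
  are bounded by 1.\<close>

lemma symbol_tendsto_0:
  assumes "\<nu> > 0 \<or> (\<exists>k\<in>A. \<alpha> k > 0)"
  shows "(symbol \<kappa> \<alpha> A \<nu> \<longlongrightarrow> 0) at_infinity"
  using assms
proof
  assume nu: "\<nu> > 0"
  have "\<forall>\<^sub>F z in at_infinity. cmod (symbol \<kappa> \<alpha> A \<nu> z) \<le> cmod z powr (- \<nu>)"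
    using eventually_Re_Ln_ge[of w0]
  proof eventually_elim
    case (elim z)
    have "cmod (symbol \<kappa> \<alpha> A \<nu> z) = cmod z powr (- \<nu>) * cmod (log_prod \<kappa> \<alpha> A (Ln z))"
      using norm_powr_neg[of z \<nu> 0] by (simp add: symbol_def norm_mult)
    also have "\<dots> \<le> cmod z powr (- \<nu>) * 1"
      using elim by (intro mult_left_mono norm_log_prod_le) auto
    finally show ?case by simp
  qed
  then show ?thesis
    by (rule Lim_null_comparison[OF _ norm_at_infinity_powr[OF nu]])
next
  assume "\<exists>k\<in>A. \<alpha> k > 0"
  then obtain j where j: "j \<in> A" "\<alpha> j > 0" by blast
  have "\<forall>\<^sub>F z in at_infinity. cmod (symbol \<kappa> \<alpha> A \<nu> z) \<le> inverse (ln (cmod z) + \<kappa> j)"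
    using eventually_Re_Ln_ge[of w0]
  proof eventually_elim
    case (elim z)
    then have nz: "z \<noteq> 0" by auto
    let ?i = "\<lambda>k. cmod (inverse (Ln z + of_real (\<kappa> k)))"
    have Re: "Re (Ln z + of_real (\<kappa> j)) = ln (cmod z) + \<kappa> j" using nz by simp
    have pos: "ln (cmod z) + \<kappa> j \<ge> 1" using w0[OF j(1)] elim nz by simp
    have "cmod (symbol \<kappa> \<alpha> A \<nu> z) = cmod z powr (- \<nu>) * cmod (log_prod \<kappa> \<alpha> A (Ln z))"
      using norm_powr_neg[of z \<nu> 0] by (simp add: symbol_def norm_mult)
    also have "\<dots> \<le> 1 * cmod (log_prod \<kappa> \<alpha> A (Ln z))"
      using elim \<nu> powr_mono2'[of "- \<nu>" 1 "cmod z"] by (intro mult_right_mono) auto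
    also have "cmod (log_prod \<kappa> \<alpha> A (Ln z)) = ?i j ^ \<alpha> j * (\<Prod>k\<in>A - {j}. ?i k ^ \<alpha> k)"
      unfolding log_prod_def prod_norm[symmetric] norm_power using fin j by (simp add: prod.remove)
    also have "\<dots> \<le> ?i j ^ 1 * 1"
      using elim j
      by (intro mult_mono power_decreasing prod_le_1 prod_nonneg conjI power_le_one norm_inverse_add_kappa_le) auto
    also have "?i j ^ 1 \<le> inverse (ln (cmod z) + \<kappa> j)"
      using pos Re complex_Re_le_cmod[of "Ln z + of_real (\<kappa> j)"]
      by (auto simp: norm_inverse intro!: le_imp_inverse_le)
    finally show ?case by simp
  qed
  moreover have "((\<lambda>z::complex. inverse (ln (cmod z) + \<kappa> j)) \<longlongrightarrow> 0) at_infinity"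
  proof (rule filterlim_compose[OF tendsto_inverse_0_at_top filterlim_norm_at_top])
    show "filterlim (\<lambda>r. ln r + \<kappa> j) at_top at_top"
      by (subst add.commute) (intro filterlim_tendsto_add_at_top[OF tendsto_const] ln_at_top)
  qed
  ultimately show ?thesis
    by (rule Lim_null_comparison)
qed

lemma symbol'_tendsto_0: "(symbol' \<kappa> \<alpha> A \<nu> \<longlongrightarrow> 0) at_infinity"
proof (rule Lim_null_comparison)
  let ?m = "\<nu> + real (\<Sum>k\<in>A. \<alpha> k)"
  show "((\<lambda>z::complex. cmod z powr (- (\<nu> + 1)) * ?m) \<longlongrightarrow> 0) at_infinity"
    using tendsto_mult_left_zero[OF norm_at_infinity_powr, of "\<nu> + 1" ?m] \<nu> by simp
  show "\<forall>\<^sub>F z in at_infinity. cmod (symbol' \<kappa> \<alpha> A \<nu> z) \<le> cmod z powr (- (\<nu> + 1)) * ?m"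
    using eventually_Re_Ln_ge[of w0]
  proof eventually_elim
    case (elim z)
    have "cmod (of_real \<nu> + log_sum 1 \<kappa> \<alpha> A (Ln z)) \<le> ?m"
      using elim \<nu> by (intro norm_triangle_mono norm_log_sum_le) auto
    then have "cmod (log_prod \<kappa> \<alpha> A (Ln z)) * cmod (of_real \<nu> + log_sum 1 \<kappa> \<alpha> A (Ln z)) \<le> 1 * ?m"
      using elim by (intro mult_mono norm_log_prod_le) auto
    moreover have "cmod (z powr (- of_real \<nu> - 1)) = cmod z powr (- (\<nu> + 1))"
      using norm_powr_neg[of z \<nu> 1] by simp
    ultimately show ?case
      by (simp add: symbol'_def norm_mult mult_left_mono)
  qed
qed

text \<open>Since |z| >= Re z, the half-plane Re z >= exp w0 is carried by Ln into Re w >= w0; the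
  poles exp (- \<kappa> k) lie to its left because - \<kappa> k <= w0 - 1.\<close>

lemma Re_ge_imp:
  assumes "Re z \<ge> exp w0"
  shows "z \<notin> \<real>\<^sub>\<le>\<^sub>0" "Re (Ln z) \<ge> w0" "\<And>k. k \<in> A \<Longrightarrow> Ln z + of_real (\<kappa> k) \<noteq> 0"
proof -
  have "Re z > 0" using assms exp_gt_zero[of w0] by linarith
  then show "z \<notin> \<real>\<^sub>\<le>\<^sub>0" by (auto simp: complex_nonpos_Reals_iff)
  then have "z \<noteq> 0" by auto
  have "exp w0 \<le> cmod z" using assms complex_Re_le_cmod[of z] by linarith
  then have "ln (exp w0) \<le> ln (cmod z)" by (intro ln_mono) auto
  then show "Re (Ln z) \<ge> w0" using \<open>z \<noteq> 0\<close> by simp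
  then show "Ln z + of_real (\<kappa> k) \<noteq> 0" if "k \<in> A" for k
    by (rule add_kappa_nonzero[OF _ that])
qed

lemma continuous_on_symbol'':
  "a \<ge> exp w0 \<Longrightarrow> continuous_on (range (Complex a)) (symbol'' \<kappa> \<alpha> A \<nu>)"
  by (intro continuous_at_imp_continuous_on ballI symbol''_isCont fin Re_ge_imp) auto

lemma integrable_symbol'':
  assumes a: "a \<ge> exp w0"
  shows "integrable lborel (\<lambda>y. symbol'' \<kappa> \<alpha> A \<nu> (Complex a y))"
proof -
  obtain B where B: "B \<ge> 0" "\<And>w. Re w \<ge> w0 \<Longrightarrow> cmod (log_kernel \<kappa> \<alpha> A \<nu> w) \<le> B"
    using log_kernel_bounded by blast
  \<comment> \<open>This allows comparison with the line Re s = 1, whose integrability is already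
    known.\<close>
  have a1: "a \<ge> 1" using a w0_nonneg one_le_exp_iff[of w0] by linarith
  show ?thesis
  proof (rule Bochner_Integration.integrable_bound)
    show "integrable lborel (\<lambda>y. B * cmod (Complex 1 y) powr (-3/2))"
      by (intro integrable_mult_right integrable_norm_Complex_powr)
    have "continuous_on UNIV (\<lambda>y. symbol'' \<kappa> \<alpha> A \<nu> (Complex a y))"
      by (rule continuous_on_compose2[OF continuous_on_symbol''[OF a] continuous_on_Complex]) auto
    then show "(\<lambda>y. symbol'' \<kappa> \<alpha> A \<nu> (Complex a y)) \<in> borel_measurable lborel"
      by (simp add: borel_measurable_continuous_onI)
    show "AE y in lborel. norm (symbol'' \<kappa> \<alpha> A \<nu> (Complex a y)) \<le> norm (B * cmod (Complex 1 y) powr (-3/2))"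
    proof (rule AE_I2)
      fix y
      have le: "cmod (Complex 1 y) \<le> cmod (Complex a y)"
        using a1 by (simp add: cmod_def)
      have g1: "cmod (Complex 1 y) \<ge> 1" by (rule norm_Complex_1_ge)
      have "cmod (symbol'' \<kappa> \<alpha> A \<nu> (Complex a y)) = cmod (Complex a y) powr (- \<nu> - 2) * cmod (log_kernel \<kappa> \<alpha> A \<nu> (Ln (Complex a y)))"
        using norm_powr_neg[of "Complex a y" \<nu> 2] by (simp add: symbol''_def norm_mult)
      also have "\<dots> \<le> cmod (Complex 1 y) powr (-3/2) * B"
      proof (rule mult_mono)
        have "cmod (Complex a y) powr (- \<nu> - 2) \<le> cmod (Complex 1 y) powr (- \<nu> - 2)"
          using le g1 \<nu> by (intro powr_mono2') auto
        also have "\<dots> \<le> cmod (Complex 1 y) powr (-3/2)"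
          using g1 \<nu> by (intro powr_mono) auto
        finally show "cmod (Complex a y) powr (- \<nu> - 2) \<le> cmod (Complex 1 y) powr (-3/2)" .
        show "cmod (log_kernel \<kappa> \<alpha> A \<nu> (Ln (Complex a y))) \<le> B"
          by (intro B Re_ge_imp) (use a in simp)
      qed auto
      finally show "norm (symbol'' \<kappa> \<alpha> A \<nu> (Complex a y)) \<le> norm (B * cmod (Complex 1 y) powr (-3/2))"
        using B(1) by (simp add: mult.commute)
    qed
  qed
qed

lemma vline_symbol_tendsto:
  assumes "\<nu> > 0 \<or> (\<exists>k\<in>A. \<alpha> k > 0)" "t > 0" "a \<ge> exp w0"
  shows "((\<lambda>R. vline a R (\<lambda>z. exp (of_real t * z) * symbol \<kappa> \<alpha> A \<nu> z)) \<longlongrightarrow>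
     \<i> * (\<integral>y. exp (of_real t * Complex a y) * symbol'' \<kappa> \<alpha> A \<nu> (Complex a y) \<partial>lborel) / of_real t ^ 2) at_top"
  by (rule vline_laplace_tendsto[where ?T1.0 = "symbol' \<kappa> \<alpha> A \<nu>"])
     (use assms in \<open>auto intro!: symbol_deriv fin Re_ge_imp symbol_tendsto_0 symbol'_tendsto_0
        continuous_on_symbol'' integrable_symbol'' dest: Re_ge_imp(3)\<close>)

end

section \<open>The asymptotic expansion\<close>

text \<open>Each w + \<kappa> k with w = 1 / x + u equals (1 + (\<kappa> k + u) x) / x, so its
  reciprocal carries one factor x. Those of \<open>log_prod\<close> give the leading power; those
  inside the \<open>log_sum\<close> terms only contribute higher corrections to \<phi>.\<close>

lemma log_kernel_expansion:
  assumes fin: "finite A" and x0: "\<And>k. k \<in> A \<Longrightarrow> x0 * \<bar>\<kappa> k\<bar> \<le> 1/2"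
  obtains \<phi> where "has_poly_expansion x0 \<phi>"
    and "\<And>x u. 0 < x \<Longrightarrow> log_kernel \<kappa> \<alpha> A \<nu> (of_real (1 / x) + u) = of_real x ^ (\<Sum>k\<in>A. \<alpha> k) * \<phi> x u"
    and "\<And>x \<l>. \<l> \<in> borel_measurable borel \<Longrightarrow> (\<lambda>y::real. \<phi> x (\<l> y)) \<in> borel_measurable borel"
proof -
  define r where "r = (\<lambda>k (x::real) (u::complex). inverse (1 + (of_real (\<kappa> k) + u) * of_real x))"
  define s where "s = (\<lambda>n (x::real) u. \<Sum>k\<in>A. of_nat (\<alpha> k) * (of_real x * r k x u) ^ n)"
  define \<phi> where "\<phi> = (\<lambda>x u. (\<Prod>k\<in>A. r k x u ^ \<alpha> k) *
     (of_real (\<nu> * (\<nu> + 1)) + of_real (2 * \<nu> + 1) * s 1 x u + s 1 x u ^ 2 + s 2 x u))"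
  have r: "has_poly_expansion x0 (r k)" if "k \<in> A" for k
    unfolding r_def by (rule has_poly_expansion_inverse[OF x0[OF that]])
  have s: "has_poly_expansion x0 (s n)" for n
    unfolding s_def
    by (intro has_poly_expansion_sum has_poly_expansion_mult has_poly_expansion_power
        has_poly_expansion_const has_poly_expansion_id r)
  have 1: "has_poly_expansion x0 \<phi>"
    unfolding \<phi>_def
    by (intro has_poly_expansion_add has_poly_expansion_mult has_poly_expansion_prod
        has_poly_expansion_power has_poly_expansion_const r s)
  have 2: "log_kernel \<kappa> \<alpha> A \<nu> (of_real (1 / x) + u) = of_real x ^ (\<Sum>k\<in>A. \<alpha> k) * \<phi> x u" if "0 < x" for x u
  proof -
    have *: "inverse (of_real (1 / x) + u + of_real (\<kappa> k)) = of_real x * r k x u" for k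
    proof -
      have "of_real (1 / x) + u + of_real (\<kappa> k) = (1 + (of_real (\<kappa> k) + u) * of_real x) * inverse (of_real x)"
        using that by (simp add: field_simps)
      then show ?thesis by (simp add: r_def mult.commute)
    qed
    have "log_prod \<kappa> \<alpha> A (of_real (1 / x) + u) = of_real x ^ (\<Sum>k\<in>A. \<alpha> k) * (\<Prod>k\<in>A. r k x u ^ \<alpha> k)"
      unfolding log_prod_def * power_mult_distrib prod.distrib power_sum ..
    then show ?thesis
      by (simp only: log_kernel_def log_sum_def * \<phi>_def s_def) (simp add: algebra_simps)
  qed
  have 3: "(\<lambda>y::real. \<phi> x (\<l> y)) \<in> borel_measurable borel" if [measurable]: "\<l> \<in> borel_measurable borel" for x \<l>
    unfolding \<phi>_def s_def r_def by measurable
  show ?thesis by (rule that[OF 1 2 3])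
qed

text \<open>The factor exp s * s^(-\<nu>-2) at s = 1 + i y: the part of the rescaled integrand that
  is free of t.\<close>

definition laplace_weight :: "real \<Rightarrow> real \<Rightarrow> complex" where
  "laplace_weight \<nu> y = exp (Complex 1 y) * Complex 1 y powr (- of_real \<nu> - 2)"

lemma borel_measurable_laplace_weight [measurable]: "laplace_weight \<nu> \<in> borel_measurable borel"
  unfolding laplace_weight_def[abs_def]
  by (intro borel_measurable_continuous_onI continuous_intros continuous_on_Complex)
     (auto simp: complex_nonpos_Reals_iff complex_eq_iff)

lemma norm_laplace_weight:
  assumes "\<nu> \<ge> 0"
  shows "cmod (laplace_weight \<nu> y) \<le> exp 1 * cmod (Complex 1 y) powr (-2)"
proof -
  have "cmod (laplace_weight \<nu> y) = exp 1 * cmod (Complex 1 y) powr (- \<nu> - 2)"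
    using norm_powr_neg[of "Complex 1 y" \<nu> 2] by (simp add: laplace_weight_def norm_mult)
  also have "\<dots> \<le> exp 1 * cmod (Complex 1 y) powr (-2)"
    using assms norm_Complex_1_ge[of y] by (intro mult_left_mono powr_mono) auto
  finally show ?thesis .
qed

text \<open>The common power of x is pulled out of the integral before expanding, which turns an
  error of order N into one of order m + N, where m is the sum of the \<alpha> k.\<close>

lemma laplace_weight_integral_expansion:
  assumes fin: "finite A" and x0: "\<And>k. k \<in> A \<Longrightarrow> x0 * \<bar>\<kappa> k\<bar> \<le> 1/2" and "\<nu> \<ge> 0"
  shows "\<exists>c :: nat \<Rightarrow> complex. \<forall>N. \<exists>C. \<forall>x. 0 < x \<and> x \<le> x0 \<longrightarrow>
     cmod ((\<integral>y. laplace_weight \<nu> y * log_kernel \<kappa> \<alpha> A \<nu> (of_real (1 / x) + Ln (Complex 1 y)) \<partial>lborel)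
        - of_real x ^ (\<Sum>k\<in>A. \<alpha> k) * (\<Sum>k<N. c k * of_real x ^ k)) \<le> C * x ^ ((\<Sum>k\<in>A. \<alpha> k) + N)"
proof -
  let ?m = "\<Sum>k\<in>A. \<alpha> k"
  obtain \<phi> where \<phi>: "has_poly_expansion x0 \<phi>"
      "\<And>x u. 0 < x \<Longrightarrow> log_kernel \<kappa> \<alpha> A \<nu> (of_real (1 / x) + u) = of_real x ^ ?m * \<phi> x u"
      "\<And>x \<l>. \<l> \<in> borel_measurable borel \<Longrightarrow> (\<lambda>y::real. \<phi> x (\<l> y)) \<in> borel_measurable borel"
    using log_kernel_expansion[where \<kappa> = \<kappa> and \<alpha> = \<alpha> and \<nu> = \<nu> and A = A, OF fin] x0 by blast
  have "\<exists>c :: nat \<Rightarrow> complex. \<forall>N. \<exists>C. \<forall>x. 0 < x \<and> x \<le> x0 \<longrightarrow>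
     cmod ((\<integral>y. laplace_weight \<nu> y * \<phi> x (Ln (Complex 1 y)) \<partial>lborel) - (\<Sum>k<N. c k * of_real x ^ k)) \<le> C * x ^ N"
    by (rule integral_poly_expansion[OF \<phi>(1)])
       (use \<open>\<nu> \<ge> 0\<close> in \<open>auto intro!: \<phi>(3) Re_Ln_Complex_1_ge integrable_weight norm_laplace_weight\<close>)
  then obtain c where c: "\<And>N. \<exists>C. \<forall>x. 0 < x \<and> x \<le> x0 \<longrightarrow>
     cmod ((\<integral>y. laplace_weight \<nu> y * \<phi> x (Ln (Complex 1 y)) \<partial>lborel) - (\<Sum>k<N. c k * of_real x ^ k)) \<le> C * x ^ N"
    by blast
  show ?thesis
  proof (intro exI[of _ c] allI)
    fix N
    obtain C where C: "\<And>x. 0 < x \<Longrightarrow> x \<le> x0 \<Longrightarrow>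
       cmod ((\<integral>y. laplace_weight \<nu> y * \<phi> x (Ln (Complex 1 y)) \<partial>lborel) - (\<Sum>k<N. c k * of_real x ^ k)) \<le> C * x ^ N"
      using c[of N] by blast
    have "cmod ((\<integral>y. laplace_weight \<nu> y * log_kernel \<kappa> \<alpha> A \<nu> (of_real (1 / x) + Ln (Complex 1 y)) \<partial>lborel)
        - of_real x ^ ?m * (\<Sum>k<N. c k * of_real x ^ k)) \<le> C * x ^ (?m + N)" if x: "0 < x" "x \<le> x0" for x
    proof -
      have "(\<integral>y. laplace_weight \<nu> y * log_kernel \<kappa> \<alpha> A \<nu> (of_real (1 / x) + Ln (Complex 1 y)) \<partial>lborel)
         = (\<integral>y. of_real x ^ ?m * (laplace_weight \<nu> y * \<phi> x (Ln (Complex 1 y))) \<partial>lborel)"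
        unfolding \<phi>(2)[OF x(1)] by (simp only: mult.left_commute)
      also have "\<dots> = of_real x ^ ?m * (\<integral>y. laplace_weight \<nu> y * \<phi> x (Ln (Complex 1 y)) \<partial>lborel)"
        by simp
      finally have "(\<integral>y. laplace_weight \<nu> y * log_kernel \<kappa> \<alpha> A \<nu> (of_real (1 / x) + Ln (Complex 1 y)) \<partial>lborel)
        - of_real x ^ ?m * (\<Sum>k<N. c k * of_real x ^ k)
        = of_real x ^ ?m * ((\<integral>y. laplace_weight \<nu> y * \<phi> x (Ln (Complex 1 y)) \<partial>lborel) - (\<Sum>k<N. c k * of_real x ^ k))"
        by (simp only: right_diff_distrib)
      also have "cmod \<dots> \<le> x ^ ?m * (C * x ^ N)"
        unfolding norm_mult norm_power norm_of_real using x C[OF x] by (simp add: mult_left_mono)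
      finally show ?thesis by (simp only: power_add mult.left_commute)
    qed
    then show "\<exists>C. \<forall>x. 0 < x \<and> x \<le> x0 \<longrightarrow>
      cmod ((\<integral>y. laplace_weight \<nu> y * log_kernel \<kappa> \<alpha> A \<nu> (of_real (1 / x) + Ln (Complex 1 y)) \<partial>lborel)
        - of_real x ^ ?m * (\<Sum>k<N. c k * of_real x ^ k)) \<le> C * x ^ (?m + N)"
      by blast
  qed
qed

text \<open>Under z = s / t the measure gives 1 / t, the power in \<open>symbol''\<close> gives
  t^(\<nu>+2), and the division by t^2 leaves t^(\<nu>-1). As 1 / t is a positive real, Ln (s / t) =
  Ln s - ln t holds without a branch correction.\<close>

lemma symbol''_integral_rescale:
  assumes t: "t > 0"
  shows "(\<integral>y. exp (of_real t * Complex (1 / t) y) * symbol'' \<kappa> \<alpha> A \<nu> (Complex (1 / t) y) \<partial>lborel) / of_real t ^ 2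
    = of_real (t powr (\<nu> - 1)) * (\<integral>y. laplace_weight \<nu> y * log_kernel \<kappa> \<alpha> A \<nu> (of_real (- ln t) + Ln (Complex 1 y)) \<partial>lborel)"
proof -
  let ?f = "\<lambda>y. exp (of_real t * Complex (1 / t) y) * symbol'' \<kappa> \<alpha> A \<nu> (Complex (1 / t) y)"
  have eq: "?f (y / t) = of_real (t powr (\<nu> + 2)) * (laplace_weight \<nu> y * log_kernel \<kappa> \<alpha> A \<nu> (of_real (- ln t) + Ln (Complex 1 y)))" for y
  proof -
    have nz: "Complex 1 y \<noteq> 0" by (simp add: complex_eq_iff)
    have z: "Complex (1 / t) (y / t) = of_real (1 / t) * Complex 1 y"
      by (simp add: complex_eq_iff)
    have Ln: "Ln (of_real (1 / t) * Complex 1 y) = of_real (- ln t) + Ln (Complex 1 y)"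
    proof -
      have "Ln (complex_of_real (1 / t)) = of_real (ln (1 / t))"
        by (rule Ln_of_real) (use t in simp)
      then show ?thesis
        using t nz by (subst Ln_times_of_real) (simp_all add: ln_div)
    qed
    have "(of_real (1 / t) * Complex 1 y) powr (- of_real \<nu> - 2) = exp ((- of_real \<nu> - 2) * of_real (- ln t)) * Complex 1 y powr (- of_real \<nu> - 2)"
      using t nz unfolding powr_def Ln by (simp add: exp_add[symmetric] algebra_simps)
    also have "(- of_real \<nu> - 2) * of_real (- ln t) = complex_of_real ((\<nu> + 2) * ln t)"
      by (simp add: algebra_simps)
    also have "exp (complex_of_real ((\<nu> + 2) * ln t)) = of_real (t powr (\<nu> + 2))"
      unfolding exp_of_real using t by (simp add: powr_def)
    finally have p: "(of_real (1 / t) * Complex 1 y) powr (- of_real \<nu> - 2) = of_real (t powr (\<nu> + 2)) * Complex 1 y powr (- of_real \<nu> - 2)" .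
    have "of_real t * (of_real (1 / t) * Complex 1 y) = Complex 1 y"
      using t by (simp add: field_simps)
    then show ?thesis
      by (simp only: z symbol''_def p Ln laplace_weight_def mult.assoc mult.left_commute)
  qed
  have "(\<integral>y. ?f y \<partial>lborel) = \<bar>1 / t\<bar> *\<^sub>R (\<integral>y. ?f (0 + (1 / t) * y) \<partial>lborel)"
    by (rule lborel_integral_real_affine) (use t in auto)
  also have "\<dots> = of_real (1 / t) * (\<integral>y. ?f (y / t) \<partial>lborel)"
    using t by (simp add: scaleR_conv_of_real)
  also have "\<dots> = of_real (1 / t) * (of_real (t powr (\<nu> + 2)) * (\<integral>y. laplace_weight \<nu> y * log_kernel \<kappa> \<alpha> A \<nu> (of_real (- ln t) + Ln (Complex 1 y)) \<partial>lborel))"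
    unfolding eq by simp
  finally have "(\<integral>y. ?f y \<partial>lborel) / of_real t ^ 2 = of_real (1 / t * t powr (\<nu> + 2) / t ^ 2)
    * (\<integral>y. laplace_weight \<nu> y * log_kernel \<kappa> \<alpha> A \<nu> (of_real (- ln t) + Ln (Complex 1 y)) \<partial>lborel)"
    by (simp add: field_simps)
  also have "1 / t * t powr (\<nu> + 2) / t ^ 2 = t powr (\<nu> - 1)"
  proof -
    have "t powr (\<nu> + 2) = t powr (\<nu> - 1) * t powr 3"
      by (simp add: powr_add[symmetric] add.commute)
    then show ?thesis using t by (simp add: field_simps eval_nat_numeral)
  qed
  finally show ?thesis .
qed

text \<open>Factors with \<alpha> k = 0 equal 1 even where Ln z = - \<kappa> k, so dropping them is
  exact and matches the condition on \<delta>, which concerns positive \<alpha> k only. At z = 0 the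
  powers would not multiply correctly, since 0 \<open>powr\<close> 0 is 0.\<close>

lemma Tab_eq_symbol:
  assumes "z \<noteq> 0"
  shows "Tab q p \<kappa> \<nu> \<alpha> \<beta> z = symbol \<kappa> \<alpha> {k \<in> {1..q}. \<alpha> k > 0} (\<Sum>k\<in>{q+1..p}. real (\<beta> k) * \<nu> k) z"
proof -
  have "(\<Prod>k\<in>S. z powr (- complex_of_real (real (\<beta> k) * \<nu> k))) = z powr (- complex_of_real (\<Sum>k\<in>S. real (\<beta> k) * \<nu> k))"
    if "finite S" for S
    using that by (induction S) (use assms in \<open>simp_all add: powr_diff powr_minus field_simps\<close>)
  moreover have "(\<Prod>k\<in>{1..q}. (Ln z + complex_of_real (\<kappa> k)) powi (- int (\<alpha> k))) = log_prod \<kappa> \<alpha> {k \<in> {1..q}. \<alpha> k > 0} (Ln z)"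
    unfolding log_prod_def
    by (rule prod.mono_neutral_cong_right) (auto simp: power_int_minus power_inverse)
  ultimately show ?thesis
    by (simp add: Tab_def symbol_def)
qed

section \<open>Where the symbol is regular\<close>

lemma symbol_field_differentiable:
  assumes "finite A" "z \<notin> \<real>\<^sub>\<le>\<^sub>0" "\<And>k. k \<in> A \<Longrightarrow> Ln z + of_real (\<kappa> k) \<noteq> 0"
  shows "symbol \<kappa> \<alpha> A \<nu> field_differentiable (at z)"
  unfolding field_differentiable_def by (rule exI, rule symbol_deriv) (use assms in auto)

text \<open>Off the real axis Ln z is not real while the shifts are, so all poles and the cut sit on
  the real axis, as the contour shift requires.\<close>

lemma Im_nonzero_imp:
  assumes "Im z \<noteq> 0"
  shows "z \<notin> \<real>\<^sub>\<le>\<^sub>0" "Ln z + complex_of_real r \<noteq> 0"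
proof -
  show "z \<notin> \<real>\<^sub>\<le>\<^sub>0" using assms by (auto simp: complex_nonpos_Reals_iff)
  have "z \<noteq> 0" using assms by auto
  then have "Im (Ln z) \<noteq> 0" using assms by (simp add: Im_Ln_eq_0)
  then show "Ln z + complex_of_real r \<noteq> 0"
    by (metis Im_complex_of_real add.right_neutral plus_complex.sel(2) zero_complex.sel(2))
qed

text \<open>The line meets the real axis only at \<delta>, where the logarithm is the real number ln
  \<delta>.\<close>

lemma Ln_vertical_nonzero:
  assumes "\<delta> > 0" "\<delta> \<noteq> exp (- r)"
  shows "Ln (Complex \<delta> y) + complex_of_real r \<noteq> 0"
proof (cases "y = 0")
  case True
  then have "Ln (Complex \<delta> y) = of_real (ln \<delta>)"
    using assms Ln_of_real[of \<delta>] by (simp add: complex_of_real_def)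
  moreover have "ln \<delta> + r \<noteq> 0"
    using assms by (metis add_eq_0_iff2 exp_ln)
  ultimately show ?thesis
    by (metis of_real_add of_real_eq_0_iff)
qed (simp add: Im_nonzero_imp)

text \<open>F is a limit of symmetric truncations because the integral may converge only
  conditionally. The condition on \<delta> keeps the line off the poles, and the last hypothesis
  excludes the symbol 1, whose truncated integrals have no limit. The asymptotic relation becomes an
  error of the size of the N-th term for every N, with g and E chosen before N.\<close>

theorem theorem8p2:
  fixes q p :: nat and \<kappa> \<nu> :: "nat \<Rightarrow> real" and \<alpha> \<beta> :: "nat \<Rightarrow> nat" and \<delta> :: real
  assumes "q \<le> p"
    and "\<forall>k\<in>{q+1..p}. 0 < \<nu> k \<and> \<nu> k < 1"
    and "\<delta> > 0"
    and "\<forall>k\<in>{1..q}. \<alpha> k > 0 \<longrightarrow> \<delta> \<noteq> exp (- \<kappa> k)"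
    and "(\<exists>k\<in>{1..q}. \<alpha> k > 0) \<or> (\<exists>k\<in>{q+1..p}. \<beta> k > 0)"
  shows "\<exists>(F :: real \<Rightarrow> complex) (g :: real \<Rightarrow> complex) (E :: nat \<Rightarrow> complex).
     (\<forall>t>0. ((\<lambda>R. contour_integral (linepath (Complex \<delta> (- R)) (Complex \<delta> R))
                    (\<lambda>z. exp (complex_of_real t * z) * Tab q p \<kappa> \<nu> \<alpha> \<beta> z) / (2 * of_real pi * \<i>))
             \<longlongrightarrow> F t) at_top) \<and>
     smooth_nonneg g \<and>
     (\<forall>N. \<exists>C. \<forall>\<^sub>F t in at_right (0::real).
        cmod (F t - g t - (\<Sum>k<N. E k * complex_of_real
                 (t powr ((\<Sum>j\<in>{q+1..p}. real (\<beta> j) * \<nu> j) - 1)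
                   / (ln t) ^ ((\<Sum>j\<in>{1..q}. \<alpha> j) + k))))
        \<le> C * t powr ((\<Sum>j\<in>{q+1..p}. real (\<beta> j) * \<nu> j) - 1)
              / \<bar>ln t\<bar> ^ ((\<Sum>j\<in>{1..q}. \<alpha> j) + N))"
proof -
  define A where "A = {k \<in> {1..q}. \<alpha> k > 0}"
  define n where "n = (\<Sum>j\<in>{q+1..p}. real (\<beta> j) * \<nu> j)"
  define m where "m = (\<Sum>j\<in>{1..q}. \<alpha> j)"
  define T where "T = symbol \<kappa> \<alpha> A n"
  \<comment> \<open>\<open>w0\<close> exceeds every |\<kappa> k| by at least 1, so w + \<kappa> k
    has real part at least 1 for Re w >= w0; \<open>x0\<close> then gives x0 |\<kappa> k| <= 1/2,
    and \<open>c\<close> lies strictly inside Re z > exp w0.\<close>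
  define w0 where "w0 = 1 + (\<Sum>k\<in>A. \<bar>\<kappa> k\<bar>)"
  define x0 where "x0 = 1 / (2 * w0)"
  define c where "c = exp w0 + 1"
  have fin: "finite A" by (simp add: A_def)
  have summand_nonneg: "0 \<le> real (\<beta> k) * \<nu> k" if "k \<in> {q+1..p}" for k
    using assms(2) that by (simp add: less_imp_le)
  then have n0: "n \<ge> 0"
    unfolding n_def by (rule sum_nonneg)
  have m_A: "m = (\<Sum>k\<in>A. \<alpha> k)"
    unfolding m_def A_def by (rule sum.mono_neutral_right) auto
  have \<kappa>_le: "\<bar>\<kappa> k\<bar> \<le> (\<Sum>k\<in>A. \<bar>\<kappa> k\<bar>)" if "k \<in> A" for k
    by (rule member_le_sum[OF that]) (use fin in auto)
  have w0: "w0 + \<kappa> k \<ge> 1" if "k \<in> A" for k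
    using \<kappa>_le[OF that] by (simp add: w0_def)
  have w0_ge: "w0 \<ge> 1" by (simp add: w0_def sum_nonneg)
  have w0_0: "w0 \<ge> 0" using w0_ge by simp
  have x0: "x0 > 0" using w0_ge by (simp add: x0_def)
  have x0_\<kappa>: "x0 * \<bar>\<kappa> k\<bar> \<le> 1/2" if "k \<in> A" for k
  proof -
    have "\<bar>\<kappa> k\<bar> \<le> w0" using \<kappa>_le[OF that] by (simp add: w0_def)
    then show ?thesis using w0_ge by (simp add: x0_def field_simps)
  qed
  have decay: "n > 0 \<or> (\<exists>k\<in>A. \<alpha> k > 0)"
  proof (cases "\<exists>k\<in>{1..q}. \<alpha> k > 0")
    case False
    then obtain k where k: "k \<in> {q+1..p}" "\<beta> k > 0" using assms(5) by blast
    have "0 < real (\<beta> k) * \<nu> k" using k assms(2) by simp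
    also have "\<dots> \<le> n"
      unfolding n_def by (rule member_le_sum[OF k(1)]) (use summand_nonneg in auto)
    finally show ?thesis by simp
  qed (auto simp: A_def)
  have hol: "T holomorphic_on {z. Im z \<noteq> 0}"
    unfolding T_def
  proof (rule holomorphic_onI)
    fix z assume "z \<in> {z. Im z \<noteq> 0}"
    then have z: "Im z \<noteq> 0" by simp
    show "symbol \<kappa> \<alpha> A n field_differentiable (at z within {z. Im z \<noteq> 0})"
      by (rule field_differentiable_at_within, rule symbol_field_differentiable[OF fin])
         (rule Im_nonzero_imp[OF z])+
  qed
  have hol_c: "T holomorphic_on {z. Re z > exp w0}"
    unfolding T_def
  proof (rule holomorphic_onI)
    fix z assume "z \<in> {z. Re z > exp w0}"
    then have z: "Re z \<ge> exp w0" by simp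
    note Re_ge_imp = Re_ge_imp[where A = A and \<kappa> = \<kappa>, OF fin _ w0_0 n0 z]
    show "symbol \<kappa> \<alpha> A n field_differentiable (at z within {z. Re z > exp w0})"
      by (rule field_differentiable_at_within, rule symbol_field_differentiable[OF fin])
         (use Re_ge_imp w0 in blast)+
  qed
  have cont: "continuous_on {z. Im z \<noteq> 0} T"
    using hol by (rule holomorphic_on_imp_continuous_on)
  have cont_\<delta>: "continuous_on (closed_segment (Complex \<delta> (-1)) (Complex \<delta> 1)) T"
    unfolding T_def
  proof (rule continuous_at_imp_continuous_on, rule ballI)
    fix z assume "z \<in> closed_segment (Complex \<delta> (-1)) (Complex \<delta> 1)"
    then obtain y where z: "z = Complex \<delta> y" by (auto simp: closed_segment_vertical)
    show "isCont (symbol \<kappa> \<alpha> A n) z"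
      unfolding z using assms(3,4)
      by (intro field_differentiable_imp_continuous_at symbol_field_differentiable fin Ln_vertical_nonzero)
         (auto simp: A_def complex_nonpos_Reals_iff)
  qed
  have cont_c: "continuous_on (closed_segment (Complex c (-1)) (Complex c 1)) T"
    by (rule continuous_on_subset[OF holomorphic_on_imp_continuous_on[OF hol_c]])
       (auto simp: closed_segment_vertical c_def)
  have T0: "(T \<longlongrightarrow> 0) at_infinity"
    unfolding T_def by (rule symbol_tendsto_0[OF fin w0 w0_0 n0 decay])
  note horizontal = horizontal_integral_tendsto_0_top_bot[OF T0 cont]

  define I where "I = (\<lambda>a t. \<i> * (\<integral>y. exp (of_real t * Complex a y) * symbol'' \<kappa> \<alpha> A n (Complex a y) \<partial>lborel) / of_real t ^ 2)"
  have I: "((\<lambda>R. vline a R (\<lambda>z. exp (of_real t * z) * T z)) \<longlongrightarrow> I a t) at_top" if "t > 0" "a \<ge> exp w0" for a t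
    unfolding I_def T_def by (rule vline_symbol_tendsto[OF fin w0 w0_0 n0 decay that])
  \<comment> \<open>The limit in R has already been taken, so the abscissa may afterwards be chosen
    as a function of t.\<close>
  have I_eq: "I a t = I b t" if "t > 0" "a > exp w0" "b > exp w0" for a b t
  proof -
    have "((\<lambda>R. vline a R (\<lambda>z. exp (of_real t * z) * T z) - vline b R (\<lambda>z. exp (of_real t * z) * T z)) \<longlongrightarrow> 0) at_top"
      by (rule contour_integral_shift_vertical_halfplane[OF _ that(2,3) horizontal])
         (intro holomorphic_intros hol_c)
    moreover have "((\<lambda>R. vline a R (\<lambda>z. exp (of_real t * z) * T z) - vline b R (\<lambda>z. exp (of_real t * z) * T z)) \<longlongrightarrow> I a t - I b t) at_top"
      using that by (intro tendsto_diff I) auto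
    ultimately have "I a t - I b t = 0"
      using tendsto_unique trivial_limit_at_top_linorder by blast
    then show ?thesis by simp
  qed

  let ?h = "\<lambda>a b t. contour_integral (linepath a b) (\<lambda>z. exp (of_real t * z) * T z)"
  \<comment> \<open>The rectangle between the abscissas \<delta> and c: t enters only through the
    exponential, hence smoothness.\<close>
  define K where "K = (\<lambda>t. ?h (Complex \<delta> (-1)) (Complex \<delta> 1) t + ?h (Complex \<delta> 1) (Complex c 1) t
     - ?h (Complex c (-1)) (Complex c 1) t - ?h (Complex \<delta> (-1)) (Complex c (-1)) t)"
  have K: "((\<lambda>R. vline \<delta> R (\<lambda>z. exp (of_real t * z) * T z) - vline c R (\<lambda>z. exp (of_real t * z) * T z)) \<longlongrightarrow> K t) at_top" for t
    unfolding K_def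
    by (rule contour_integral_shift_vertical[OF _ _ _ horizontal])
       (intro holomorphic_intros hol continuous_intros cont_\<delta> cont_c)+
  have horiz_seg: "closed_segment (Complex \<delta> y) (Complex c y) \<subseteq> {z. Im z \<noteq> 0}" if "y \<noteq> 0" for y
    using that by (auto simp: closed_segment_same_Im)
  have smooth_K: "smooth_nonneg K"
  proof -
    have "smooth_nonneg (\<lambda>t. ((?h (Complex \<delta> (-1)) (Complex \<delta> 1) t + ?h (Complex \<delta> 1) (Complex c 1) t)
     + (-1) * ?h (Complex c (-1)) (Complex c 1) t) + (-1) * ?h (Complex \<delta> (-1)) (Complex c (-1)) t)"
      by (intro smooth_nonneg_add smooth_nonneg_cmult smooth_nonneg_laplace_linepath cont_\<delta> cont_c
          continuous_on_subset[OF cont horiz_seg]) auto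
    then show ?thesis by (simp add: K_def[abs_def])
  qed

  obtain e where e: "\<And>N. \<exists>C. \<forall>x. 0 < x \<and> x \<le> x0 \<longrightarrow>
     cmod ((\<integral>y. laplace_weight n y * log_kernel \<kappa> \<alpha> A n (of_real (1 / x) + Ln (Complex 1 y)) \<partial>lborel)
        - of_real x ^ m * (\<Sum>k<N. e k * of_real x ^ k)) \<le> C * x ^ (m + N)"
    using laplace_weight_integral_expansion[where \<kappa> = \<kappa> and \<alpha> = \<alpha>, OF fin _ n0] x0_\<kappa> unfolding m_A by blast

  \<comment> \<open>The factor i inside \<open>I\<close> cancels against 2 pi i, so \<open>E\<close>
    has denominator 2 pi. Its signs come from x = - 1 / ln t, since the theorem uses powers of ln t
    rather than of log (1/t).\<close>
  define F where "F = (\<lambda>t. (K t + I c t) / (2 * of_real pi * \<i>))"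
  define g where "g = (\<lambda>t. 1 / (2 * of_real pi * \<i>) * K t)"
  define E where "E = (\<lambda>k. (-1) ^ (m + k) * e k / (2 * of_real pi))"

  have "((\<lambda>R. vline \<delta> R (\<lambda>z. exp (of_real t * z) * Tab q p \<kappa> \<nu> \<alpha> \<beta> z) / (2 * of_real pi * \<i>)) \<longlongrightarrow> F t) at_top"
    if t: "t > 0" for t
  proof -
    have "((\<lambda>R. ((vline \<delta> R (\<lambda>z. exp (of_real t * z) * T z) - vline c R (\<lambda>z. exp (of_real t * z) * T z))
        + vline c R (\<lambda>z. exp (of_real t * z) * T z)) / (2 * of_real pi * \<i>)) \<longlongrightarrow> F t) at_top"
      unfolding F_def by (intro tendsto_intros K I t) (auto simp: c_def)
    moreover have "vline \<delta> R (\<lambda>z. exp (of_real t * z) * Tab q p \<kappa> \<nu> \<alpha> \<beta> z) = vline \<delta> R (\<lambda>z. exp (of_real t * z) * T z)" for R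
    proof (rule contour_integral_eq)
      fix z assume "z \<in> path_image (linepath (Complex \<delta> (- R)) (Complex \<delta> R))"
      then have "z \<noteq> 0" using assms(3) by (auto simp: closed_segment_vertical complex_eq_iff)
      then show "exp (of_real t * z) * Tab q p \<kappa> \<nu> \<alpha> \<beta> z = exp (of_real t * z) * T z"
        by (simp add: Tab_eq_symbol T_def A_def n_def)
    qed
    ultimately show ?thesis by simp
  qed
  moreover have "smooth_nonneg g"
    unfolding g_def by (rule smooth_nonneg_cmult[OF smooth_K])
  moreover have "\<exists>C. \<forall>\<^sub>F t in at_right (0::real).
        cmod (F t - g t - (\<Sum>k<N. E k * of_real (t powr (n - 1) / (ln t) ^ (m + k))))
        \<le> C * t powr (n - 1) / \<bar>ln t\<bar> ^ (m + N)" for N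
  proof -
    obtain C where C: "\<And>x. 0 < x \<Longrightarrow> x \<le> x0 \<Longrightarrow>
     cmod ((\<integral>y. laplace_weight n y * log_kernel \<kappa> \<alpha> A n (of_real (1 / x) + Ln (Complex 1 y)) \<partial>lborel)
        - of_real x ^ m * (\<Sum>k<N. e k * of_real x ^ k)) \<le> C * x ^ (m + N)"
      using e[of N] by blast
    \<comment> \<open>Below 1 / c the line Re z = 1 / t lies right of c; below exp (- 1 / x0) the
      variable x = - 1 / ln t lies in the range (0, x0] of the expansion.\<close>
    define t0 where "t0 = min (1 / c) (exp (- 1 / x0))"
    have c0: "c > 0" by (simp add: c_def add_pos_pos)
    have "t0 > 0" using c0 by (simp add: t0_def)
    have "cmod (F t - g t - (\<Sum>k<N. E k * of_real (t powr (n - 1) / (ln t) ^ (m + k))))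
        \<le> (C / (2 * pi)) * t powr (n - 1) / \<bar>ln t\<bar> ^ (m + N)" if t: "0 < t" "t < t0" for t
    proof -
      define x where "x = - 1 / ln t"
      have "ln t < ln (exp (- 1 / x0))"
        using t unfolding t0_def by (subst ln_less_cancel_iff) auto
      then have "ln t < - 1 / x0" by simp
      then have lt: "ln t < 0" "1 / x0 \<le> - ln t"
        using x0 by (auto intro: less_trans[of _ "- (1 / x0)"])
      have x: "0 < x" "x \<le> x0" "1 / x = - ln t" "x = 1 / \<bar>ln t\<bar>"
        using lt x0 by (auto simp: x_def field_simps)
      let ?J = "\<integral>y. laplace_weight n y * log_kernel \<kappa> \<alpha> A n (of_real (1 / x) + Ln (Complex 1 y)) \<partial>lborel"
      let ?P = "complex_of_real (t powr (n - 1) / (2 * pi))"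
      \<comment> \<open>Only here does the abscissa become t-dependent; it is the choice that makes
        the rescaled line Re s = 1 the same for all t.\<close>
      have "1 / t > c" using t c0 by (simp add: t0_def field_simps)
      then have "I c t = I (1 / t) t"
        using t by (intro I_eq) (auto simp: c_def)
      also have "\<dots> = \<i> * (of_real (t powr (n - 1)) * ?J)"
        unfolding I_def times_divide_eq_right[symmetric] symbol''_integral_rescale[OF t(1)] x(3) ..
      finally have "F t - g t = ?P * ?J"
        by (simp add: F_def g_def field_simps)
      moreover have "(\<Sum>k<N. E k * of_real (t powr (n - 1) / (ln t) ^ (m + k))) = ?P * (of_real x ^ m * (\<Sum>k<N. e k * of_real x ^ k))"
      proof -
        have "E k * of_real (t powr (n - 1) / (ln t) ^ (m + k)) = ?P * (of_real x ^ m * (e k * of_real x ^ k))" for k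
        proof -
          have "complex_of_real x ^ (m + k) = (-1) ^ (m + k) / of_real (ln t) ^ (m + k)"
            by (simp only: x_def of_real_divide of_real_minus of_real_1 power_divide)
          then have "(-1) ^ (m + k) / complex_of_real (ln t) ^ (m + k) = of_real x ^ m * of_real x ^ k"
            by (simp only: power_add)
          moreover have "E k * of_real (t powr (n - 1) / (ln t) ^ (m + k)) = ?P * (((-1) ^ (m + k) / complex_of_real (ln t) ^ (m + k)) * e k)"
            by (simp add: E_def)
          ultimately show ?thesis by simp
        qed
        then show ?thesis by (simp add: sum_distrib_left)
      qed
      ultimately have "F t - g t - (\<Sum>k<N. E k * of_real (t powr (n - 1) / (ln t) ^ (m + k)))
        = ?P * (?J - of_real x ^ m * (\<Sum>k<N. e k * of_real x ^ k))"
        by (simp only: right_diff_distrib)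
      also have "cmod \<dots> \<le> (t powr (n - 1) / (2 * pi)) * (C * x ^ (m + N))"
        unfolding norm_mult by (intro mult_mono C x) (auto simp: norm_divide norm_mult)
      also have "\<dots> = (C / (2 * pi)) * t powr (n - 1) / \<bar>ln t\<bar> ^ (m + N)"
        unfolding x(4) by (simp add: power_divide)
      finally show ?thesis .
    qed
    with \<open>t0 > 0\<close> have "\<forall>\<^sub>F t in at_right (0::real).
        cmod (F t - g t - (\<Sum>k<N. E k * of_real (t powr (n - 1) / (ln t) ^ (m + k))))
        \<le> (C / (2 * pi)) * t powr (n - 1) / \<bar>ln t\<bar> ^ (m + N)"
      unfolding eventually_at_right_field by blast
    then show ?thesis by blast
  qed
  ultimately show ?thesis
    unfolding n_def m_def by blast
qed

end
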